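(* Let $X$ be a Banach space, let $(\Omega,\mathcal{A},\mu)$ be a finite measure space, and let $1\le p\le\infty$. Suppose $L_p(\mu)\neq\{0\}$. If $X$ has the DD2P (respectively, the DLD2P, the convex DLD2P), then the Lebesgue--Bochner space $L_p(\mu,X)$ also has the DD2P (respectively, the DLD2P, the convex DLD2P).
   Context: All Banach spaces are real and nontrivial (i.e. $\neq\{0\}$). $B_X$, $S_X$, $X^\ast$ denote the closed unit ball, the unit sphere and the dual space of $X$. A slice of $B_X$ is a set of the form $\{x\in B_X: x^\ast(x)>1-\alpha\}$ with $x^\ast\in S_{X^\ast}$ and $\alpha>0$. $X$ has the DD2P (diametral diameter two property) if for every nonempty relatively weakly open subset $U$ of $B_X$, every $x\in U\cap S_X$ and every $\varepsilon>0$ there exists $y\in U$ with $\|x-y\|\ge 2-\varepsilon$. $X$ has the DLD2P (diametral local diameter two property) if for every slice $S$ of $B_X$, every $x\in S\cap S_X$ and every $\varepsilon>0$ there exists $y\in S$ with $\|x-y\|\ge 2-\varepsilon$. For $x\in S_X$ and $\varepsilon>0$ let $\Delta^X_\varepsilon(x)=\{y\in B_X:\|x-y\|\ge 2-\varepsilon\}$; $x\in S_X$ is a $\Delta$-point if $x\in\overline{\mathrm{conv}}\,\Delta^X_\varepsilon(x)$ (norm-closed convex hull) for every $\varepsilon>0$, and $\Delta_X$ is the set of all $\Delta$-points of $X$. $X$ has the convex DLD2P if $B_X=\overline{\mathrm{conv}}\,\Delta_X$. $L_p(\mu,X)$ is the Banach space of ($\mu$-a.e. equivalence classes of) Bochner-measurable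 functions $f\colon\Omega\to X$ (i.e. $\mu$-a.e. norm limits of sequences of finitely-valued measurable functions) such that $\|f(\cdot)\|\in L_p(\mu)$, with norm $\big\|\,\|f(\cdot)\|\,\big\|_{L_p(\mu)}$. *)

theory Defs
  imports "HOL-Probability.Essential_Supremum"
begin

section \<open>Normed spaces with an explicit carrier\<close>

text \<open>
  The space \<open>L\<^sub>p(\<mu>, X)\<close> depends on the values \<open>\<mu>\<close> and \<open>p\<close>, so it cannot be
  a type of class \<^class>\<open>real_normed_vector\<close>. The geometric notions below are therefore stated for
  real normed spaces given by a carrier set with operations; a Banach space given as a type is
  viewed this way through \<open>space_of\<close>.
\<close>

record 'v nspace =
  ncarrier :: "'v set"
  nadd :: "'v \<Rightarrow> 'v \<Rightarrow> 'v"
  nzero :: "'v"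
  nscale :: "real \<Rightarrow> 'v \<Rightarrow> 'v"
  nnorm :: "'v \<Rightarrow> real"

definition ndist :: "'v nspace \<Rightarrow> 'v \<Rightarrow> 'v \<Rightarrow> real" where
  "ndist E x y = nnorm E (nadd E x (nscale E (-1) y))"

definition unit_ball :: "'v nspace \<Rightarrow> 'v set" where
  "unit_ball E = {x \<in> ncarrier E. nnorm E x \<le> 1}"

definition unit_sphere :: "'v nspace \<Rightarrow> 'v set" where
  "unit_sphere E = {x \<in> ncarrier E. nnorm E x = 1}"

text \<open>
  Functionals are total functions on the underlying type; only their values on the carrier matter.
\<close>

definition dual_space :: "'v nspace \<Rightarrow> ('v \<Rightarrow> real) set" where
  "dual_space E = {\<phi>.
     (\<forall>x\<in>ncarrier E. \<forall>y\<in>ncarrier E. \<phi> (nadd E x y) = \<phi> x + \<phi> y) \<and>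
     (\<forall>c. \<forall>x\<in>ncarrier E. \<phi> (nscale E c x) = c * \<phi> x) \<and>
     (\<exists>K. \<forall>x\<in>ncarrier E. \<bar>\<phi> x\<bar> \<le> K * nnorm E x)}"

definition dual_norm :: "'v nspace \<Rightarrow> ('v \<Rightarrow> real) \<Rightarrow> real" where
  "dual_norm E \<phi> = (SUP x\<in>unit_ball E. \<bar>\<phi> x\<bar>)"

definition dual_sphere :: "'v nspace \<Rightarrow> ('v \<Rightarrow> real) set" where
  "dual_sphere E = {\<phi> \<in> dual_space E. dual_norm E \<phi> = 1}"

definition slice :: "'v nspace \<Rightarrow> ('v \<Rightarrow> real) \<Rightarrow> real \<Rightarrow> 'v set" where
  "slice E \<phi> \<alpha> = {x \<in> unit_ball E. \<phi> x > 1 - \<alpha>}"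

definition weak_topology :: "'v nspace \<Rightarrow> 'v topology" where
  "weak_topology E =
     topology_generated_by {{x \<in> ncarrier E. \<phi> x \<in> V} | \<phi> V. \<phi> \<in> dual_space E \<and> open V}"

definition convex_subset :: "'v nspace \<Rightarrow> 'v set \<Rightarrow> bool" where
  "convex_subset E S \<longleftrightarrow> S \<subseteq> ncarrier E \<and>
     (\<forall>x\<in>S. \<forall>y\<in>S. \<forall>u\<ge>0. \<forall>v\<ge>0. u + v = 1 \<longrightarrow> nadd E (nscale E u x) (nscale E v y) \<in> S)"

definition norm_closure :: "'v nspace \<Rightarrow> 'v set \<Rightarrow> 'v set" where
  "norm_closure E S = {x \<in> ncarrier E. \<forall>e>0. \<exists>y\<in>S. ndist E x y < e}"

definition closed_conv :: "'v nspace \<Rightarrow> 'v set \<Rightarrow> 'v set" where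
  "closed_conv E S = norm_closure E (convex_subset E hull S)"


section \<open>Diametral diameter two properties\<close>

definition DD2P :: "'v nspace \<Rightarrow> bool" where
  "DD2P E \<longleftrightarrow> (\<forall>U. openin (subtopology (weak_topology E) (unit_ball E)) U \<and> U \<noteq> {} \<longrightarrow>
     (\<forall>x \<in> U \<inter> unit_sphere E. \<forall>\<epsilon>>0. \<exists>y\<in>U. ndist E x y \<ge> 2 - \<epsilon>))"

definition DLD2P :: "'v nspace \<Rightarrow> bool" where
  "DLD2P E \<longleftrightarrow> (\<forall>\<phi>\<in>dual_sphere E. \<forall>\<alpha>>0.
     (\<forall>x \<in> slice E \<phi> \<alpha> \<inter> unit_sphere E. \<forall>\<epsilon>>0. \<exists>y\<in>slice E \<phi> \<alpha>. ndist E x y \<ge> 2 - \<epsilon>))"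

definition far_points :: "'v nspace \<Rightarrow> real \<Rightarrow> 'v \<Rightarrow> 'v set" where
  "far_points E \<epsilon> x = {y \<in> unit_ball E. ndist E x y \<ge> 2 - \<epsilon>}"

definition Delta_points :: "'v nspace \<Rightarrow> 'v set" where
  "Delta_points E = {x \<in> unit_sphere E. \<forall>\<epsilon>>0. x \<in> closed_conv E (far_points E \<epsilon> x)}"

definition convex_DLD2P :: "'v nspace \<Rightarrow> bool" where
  "convex_DLD2P E \<longleftrightarrow> unit_ball E = closed_conv E (Delta_points E)"


section \<open>Normed spaces given as types\<close>

definition space_of :: "'a::real_normed_vector itself \<Rightarrow> 'a nspace" where
  "space_of T = \<lparr>ncarrier = UNIV, nadd = (+), nzero = 0, nscale = scaleR, nnorm = norm\<rparr>"

lemma space_of_sel [simp]: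
  "ncarrier (space_of T) = UNIV" "nadd (space_of T) = (+)" "nzero (space_of T) = 0"
  "nscale (space_of T) = scaleR" "nnorm (space_of T) = norm"
  by (simp_all add: space_of_def)

lemma ndist_space_of: "ndist (space_of T) x y = norm (x - y)"
  by (simp add: ndist_def)

lemma unit_ball_space_of: "unit_ball (space_of T) = cball 0 1"
  by (auto simp: unit_ball_def)

lemma unit_sphere_space_of: "unit_sphere (space_of T) = sphere 0 1"
  by (auto simp: unit_sphere_def)

lemma dual_space_space_of: "\<phi> \<in> dual_space (space_of T) \<longleftrightarrow> bounded_linear \<phi>"
  by (auto simp: dual_space_def bounded_linear_def bounded_linear_axioms_def linear_iff mult.commute)

lemma closed_conv_space_of: "closed_conv (space_of T) S = closure (convex hull S)"
proof -
  have "convex_subset (space_of T) = convex"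
    by (auto simp: fun_eq_iff convex_subset_def convex_def)
  then show ?thesis
    by (auto simp: closed_conv_def norm_closure_def ndist_space_of closure_approachable dist_norm
        norm_minus_commute)
qed


section \<open>Lebesgue-Bochner spaces\<close>

definition Bochner_measurable :: "'w measure \<Rightarrow> ('w \<Rightarrow> 'a::real_normed_vector) \<Rightarrow> bool" where
  "Bochner_measurable M f \<longleftrightarrow>
     (\<exists>s. (\<forall>i. simple_function M (s i)) \<and> (AE x in M. (\<lambda>i. s i x) \<longlonglongrightarrow> f x))"

text \<open>
  A Bochner measurable function is only almost everywhere a limit of measurable functions, so it is
  measurable with respect to the completion of \<open>M\<close> but possibly not with respect to \<open>M\<close> itself.
  Since \<^const>\<open>lebesgue_integral\<close> and \<^const>\<open>esssup\<close> take junk values on non-measurable functions, they are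
  formed with respect to \<^term>\<open>completion M\<close>.
\<close>

definition Lp_member :: "'w measure \<Rightarrow> ennreal \<Rightarrow> ('w \<Rightarrow> real) \<Rightarrow> bool" where
  "Lp_member M p g \<longleftrightarrow> g \<in> borel_measurable (completion M) \<and>
     (if p = \<infinity> then esssup (completion M) (\<lambda>x. ereal \<bar>g x\<bar>) < \<infinity>
      else integrable (completion M) (\<lambda>x. \<bar>g x\<bar> powr enn2real p))"

definition Lp_norm :: "'w measure \<Rightarrow> ennreal \<Rightarrow> ('w \<Rightarrow> real) \<Rightarrow> real" where
  "Lp_norm M p g =
     (if p = \<infinity> then real_of_ereal (esssup (completion M) (\<lambda>x. ereal \<bar>g x\<bar>))
      else (\<integral>x. \<bar>g x\<bar> powr enn2real p \<partial>completion M) powr (1 / enn2real p))"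

definition Lp_functions :: "'w measure \<Rightarrow> ennreal \<Rightarrow> ('w \<Rightarrow> 'a::real_normed_vector) set" where
  "Lp_functions M p = {f. Bochner_measurable M f \<and> Lp_member M p (\<lambda>x. norm (f x))}"

definition ae_eq :: "'w measure \<Rightarrow> (('w \<Rightarrow> 'a::real_normed_vector) \<times> ('w \<Rightarrow> 'a)) set" where
  "ae_eq M = {(f, g). Bochner_measurable M f \<and> Bochner_measurable M g \<and> (AE x in M. f x = g x)}"

definition ae_class :: "'w measure \<Rightarrow> ('w \<Rightarrow> 'a::real_normed_vector) \<Rightarrow> ('w \<Rightarrow> 'a) set" where
  "ae_class M f = ae_eq M `` {f}"

definition rep :: "('w \<Rightarrow> 'a) set \<Rightarrow> 'w \<Rightarrow> 'a" where
  "rep F = (SOME f. f \<in> F)"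

definition Lp :: "'w measure \<Rightarrow> ennreal \<Rightarrow> 'a::real_normed_vector itself \<Rightarrow> ('w \<Rightarrow> 'a) set nspace" where
  "Lp M p T = \<lparr>
     ncarrier = Lp_functions M p // ae_eq M,
     nadd = (\<lambda>F G. ae_class M (\<lambda>x. rep F x + rep G x)),
     nzero = ae_class M (\<lambda>x. 0),
     nscale = (\<lambda>c F. ae_class M (\<lambda>x. c *\<^sub>R rep F x)),
     nnorm = (\<lambda>F. Lp_norm M p (\<lambda>x. norm (rep F x)))\<rparr>"

text \<open>The operations and the norm do not depend on the chosen representatives.\<close>

lemma Bochner_measurable_add:
  assumes "Bochner_measurable M f" "Bochner_measurable M g"
  shows "Bochner_measurable M (\<lambda>x. f x + g x)"
proof -
  obtain s t where s: "\<And>i. simple_function M (s i)" "AE x in M. (\<lambda>i. s i x) \<longlonglongrightarrow> f x"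
    and t: "\<And>i. simple_function M (t i)" "AE x in M. (\<lambda>i. t i x) \<longlonglongrightarrow> g x"
    using assms unfolding Bochner_measurable_def by blast
  have "AE x in M. (\<lambda>i. s i x + t i x) \<longlonglongrightarrow> f x + g x"
    using s(2) t(2) by eventually_elim (rule tendsto_add)
  moreover have "simple_function M (\<lambda>x. s i x + t i x)" for i
    using s(1) t(1) by (rule simple_function_compose2)
  ultimately show ?thesis
    unfolding Bochner_measurable_def by (intro exI[of _ "\<lambda>i x. s i x + t i x"]) blast
qed

lemma Bochner_measurable_scaleR:
  assumes "Bochner_measurable M f"
  shows "Bochner_measurable M (\<lambda>x. c *\<^sub>R f x)"
proof -
  obtain s where s: "\<And>i. simple_function M (s i)" "AE x in M. (\<lambda>i. s i x) \<longlonglongrightarrow> f x"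
    using assms unfolding Bochner_measurable_def by blast
  have "AE x in M. (\<lambda>i. c *\<^sub>R s i x) \<longlonglongrightarrow> c *\<^sub>R f x"
    using s(2) by eventually_elim (intro tendsto_intros)
  moreover have "simple_function M (\<lambda>x. c *\<^sub>R s i x)" for i
    using s(1) by (rule simple_function_compose1)
  ultimately show ?thesis
    unfolding Bochner_measurable_def by (intro exI[of _ "\<lambda>i x. c *\<^sub>R s i x"]) blast
qed

lemma Bochner_measurable_norm:
  assumes "Bochner_measurable M f"
  shows "(\<lambda>x. norm (f x)) \<in> borel_measurable (completion M)"
proof -
  obtain s where s: "\<And>i. simple_function M (s i)" "AE x in M. (\<lambda>i. s i x) \<longlonglongrightarrow> f x"
    using assms unfolding Bochner_measurable_def by blast
  define h where "h x = lim (\<lambda>i. norm (s i x))" for x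
  have "(\<lambda>x. norm (s i x)) \<in> borel_measurable M" for i
    by (rule borel_measurable_simple_function[OF simple_function_compose1[OF s(1)]])
  then have "h \<in> borel_measurable M"
    unfolding h_def by (rule borel_measurable_lim_metric)
  then have h: "h \<in> borel_measurable (completion M)"
    by (rule measurable_completion)
  have "AE x in M. h x = norm (f x)"
    using s(2) unfolding h_def by eventually_elim (intro limI tendsto_norm)
  then have ae: "AE x in completion M. h x = norm (f x)"
    by (rule AE_completion)
  show ?thesis
  proof (rule measurableI)
    fix A :: "real set" assume A: "A \<in> sets borel"
    show "(\<lambda>x. norm (f x)) -` A \<inter> space (completion M) \<in> sets (completion M)"
    proof (rule completion.in_sets_AE)
      show "AE x in completion M. x \<in> h -` A \<inter> space (completion M) \<longleftrightarrow>
          x \<in> (\<lambda>x. norm (f x)) -` A \<inter> space (completion M)"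
        using ae by eventually_elim auto
      show "h -` A \<inter> space (completion M) \<in> sets (completion M)"
        using h A by (rule measurable_sets)
    qed blast
  qed simp
qed

lemma equiv_ae_eq:
  fixes M :: "'w measure"
  shows "equiv {f. Bochner_measurable M (f :: 'w \<Rightarrow> 'a::real_normed_vector)} (ae_eq M)"
proof (rule equivI)
  show "trans (ae_eq M :: (('w \<Rightarrow> 'a) \<times> ('w \<Rightarrow> 'a)) set)"
  proof (rule transI)
    fix f g h :: "'w \<Rightarrow> 'a" assume a: "(f, g) \<in> ae_eq M" "(g, h) \<in> ae_eq M"
    then have "AE x in M. f x = g x" "AE x in M. g x = h x"
      by (simp_all add: ae_eq_def)
    then have "AE x in M. f x = h x"
      by eventually_elim simp
    then show "(f, h) \<in> ae_eq M"
      using a by (simp add: ae_eq_def)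
  qed
qed (auto simp: ae_eq_def refl_on_def sym_def eq_commute)

lemma ae_class_eqI:
  assumes "Bochner_measurable M f" "Bochner_measurable M g" "AE x in M. f x = g x"
  shows "ae_class M f = ae_class M g"
proof -
  have "AE x in M. f x = h x \<longleftrightarrow> g x = h x" for h
    using assms(3) by eventually_elim simp
  then have "(AE x in M. f x = h x) \<longleftrightarrow> (AE x in M. g x = h x)" for h
    by (rule eventually_subst)
  then show ?thesis
    using assms(1,2) by (auto simp: ae_class_def ae_eq_def)
qed

lemma rep_ae_class:
  assumes "Bochner_measurable M f"
  shows "Bochner_measurable M (rep (ae_class M f))" "AE x in M. rep (ae_class M f) x = f x"
proof -
  have "f \<in> ae_class M f"
    using assms by (auto simp: ae_class_def ae_eq_def)
  then have "rep (ae_class M f) \<in> ae_class M f"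
    unfolding rep_def by (rule someI[where P = "\<lambda>g. g \<in> ae_class M f"])
  then show "Bochner_measurable M (rep (ae_class M f))" "AE x in M. rep (ae_class M f) x = f x"
    by (auto simp: ae_class_def ae_eq_def eq_commute)
qed

lemma nadd_Lp:
  assumes f: "Bochner_measurable M f" and g: "Bochner_measurable M g"
  shows "nadd (Lp M p T) (ae_class M f) (ae_class M g) = ae_class M (\<lambda>x. f x + g x)"
proof -
  have "nadd (Lp M p T) (ae_class M f) (ae_class M g) =
      ae_class M (\<lambda>x. rep (ae_class M f) x + rep (ae_class M g) x)"
    by (simp only: Lp_def nspace.select_convs)
  also have "\<dots> = ae_class M (\<lambda>x. f x + g x)"
  proof (rule ae_class_eqI)
    show "AE x in M. rep (ae_class M f) x + rep (ae_class M g) x = f x + g x"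
      using rep_ae_class(2)[OF f] rep_ae_class(2)[OF g] by eventually_elim (rule arg_cong2)
  qed (intro Bochner_measurable_add rep_ae_class(1) f g)+
  finally show ?thesis .
qed

lemma nscale_Lp:
  assumes f: "Bochner_measurable M f"
  shows "nscale (Lp M p T) c (ae_class M f) = ae_class M (\<lambda>x. c *\<^sub>R f x)"
proof -
  have "nscale (Lp M p T) c (ae_class M f) = ae_class M (\<lambda>x. c *\<^sub>R rep (ae_class M f) x)"
    by (simp only: Lp_def nspace.select_convs)
  also have "\<dots> = ae_class M (\<lambda>x. c *\<^sub>R f x)"
  proof (rule ae_class_eqI)
    show "AE x in M. c *\<^sub>R rep (ae_class M f) x = c *\<^sub>R f x"
      using rep_ae_class(2)[OF f] by eventually_elim (rule arg_cong)
  qed (intro Bochner_measurable_scaleR rep_ae_class(1) f)+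
  finally show ?thesis .
qed

lemma nnorm_Lp:
  assumes "Bochner_measurable M f"
  shows "nnorm (Lp M p T) (ae_class M f) = Lp_norm M p (\<lambda>x. norm (f x))"
proof -
  define r where "r = rep (ae_class M f)"
  have [measurable]: "(\<lambda>x. norm (r x)) \<in> borel_measurable (completion M)"
      "(\<lambda>x. norm (f x)) \<in> borel_measurable (completion M)"
    using assms rep_ae_class(1)[OF assms] by (auto simp: r_def intro: Bochner_measurable_norm)
  have ae: "AE x in completion M. r x = f x"
    using rep_ae_class(2)[OF assms] unfolding r_def by (rule AE_completion)
  have "esssup (completion M) (\<lambda>x. ereal \<bar>norm (r x)\<bar>) = esssup (completion M) (\<lambda>x. ereal \<bar>norm (f x)\<bar>)"
  proof (intro esssup_AE_cong)
    show "AE x in completion M. ereal \<bar>norm (r x)\<bar> = ereal \<bar>norm (f x)\<bar>"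
      using ae by eventually_elim simp
  qed measurable
  moreover have "(\<integral>x. \<bar>norm (r x)\<bar> powr q \<partial>completion M) = (\<integral>x. \<bar>norm (f x)\<bar> powr q \<partial>completion M)" for q
  proof (intro integral_cong_AE)
    show "AE x in completion M. \<bar>norm (r x)\<bar> powr q = \<bar>norm (f x)\<bar> powr q"
      using ae by eventually_elim simp
  qed measurable
  ultimately show ?thesis
    by (simp add: Lp_def Lp_norm_def r_def)
qed

end

theory Submission
  imports Defs
begin

text \<open>
  Let \<open>f\<close> be a norm-one element of \<open>L\<^sub>p(\<mu>, X)\<close>. Up to a small error, \<open>f\<close> has constant values
  \<open>v i \<noteq> 0\<close> on finitely many disjoint sets \<open>A i\<close> whose union already carries the whole norm. For \<open>p < \<infinity>\<close>
  this is the density of simple functions. For \<open>p = \<infinity>\<close> simple functions need not be dense, but there one set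
  suffices: a set of positive measure on which \<open>f\<close> is almost constant with almost maximal norm.
  Replace each direction \<open>v i / \<parallel>v i\<parallel>\<close> by a point \<open>z i\<close> of the unit ball of \<open>X\<close>. The resulting function
  stays in the unit ball, has norm one if all \<open>z i\<close> do, and moves by at least \<open>2 - \<epsilon>\<close> if all
  directions do. A functional on \<open>L\<^sub>p(\<mu>, X)\<close> restricts to a functional on \<open>X\<close> through each \<open>A i\<close>, so
  applying the DD2P or DLD2P of \<open>X\<close> to each direction gives the same property of \<open>L\<^sub>p(\<mu>, X)\<close>.
  The function is moreover affine in each \<open>z i\<close> separately. Hence it is a \<open>\<Delta>\<close>-point if all \<open>z i\<close> are, and
  if \<open>\<Delta>\<^sub>X\<close> has closed convex hull \<open>B\<^sub>X\<close>, then \<open>f\<close> is a limit of convex combinations of such functions.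
\<close>

section \<open>Geometry of normed spaces with an explicit carrier\<close>

text \<open>The zero vector enters as \<open>nscale E 0 y\<close> and subtraction as adding
  \<open>nscale E (-1) y\<close>, so that addition, scaling and norm carry all the axioms.\<close>

locale normed_nspace =
  fixes E :: "'v nspace"
  assumes add_closed [simp]:
      "x \<in> ncarrier E \<Longrightarrow> y \<in> ncarrier E \<Longrightarrow> nadd E x y \<in> ncarrier E"
    and scale_closed [simp]: "x \<in> ncarrier E \<Longrightarrow> nscale E c x \<in> ncarrier E"
    and add_assoc: "x \<in> ncarrier E \<Longrightarrow> y \<in> ncarrier E \<Longrightarrow> z \<in> ncarrier E \<Longrightarrow>
      nadd E (nadd E x y) z = nadd E x (nadd E y z)"
    and add_commute: "x \<in> ncarrier E \<Longrightarrow> y \<in> ncarrier E \<Longrightarrow> nadd E x y = nadd E y x"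
    and add_scale_zero: "x \<in> ncarrier E \<Longrightarrow> y \<in> ncarrier E \<Longrightarrow> nadd E x (nscale E 0 y) = x"
    and scale_add_right: "x \<in> ncarrier E \<Longrightarrow> y \<in> ncarrier E \<Longrightarrow>
      nscale E c (nadd E x y) = nadd E (nscale E c x) (nscale E c y)"
    and scale_add_left: "x \<in> ncarrier E \<Longrightarrow>
      nscale E (c + d) x = nadd E (nscale E c x) (nscale E d x)"
    and scale_scale [simp]: "x \<in> ncarrier E \<Longrightarrow> nscale E c (nscale E d x) = nscale E (c * d) x"
    and scale_one [simp]: "x \<in> ncarrier E \<Longrightarrow> nscale E 1 x = x"
    and norm_triangle: "x \<in> ncarrier E \<Longrightarrow> y \<in> ncarrier E \<Longrightarrow>
      nnorm E (nadd E x y) \<le> nnorm E x + nnorm E y"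
    and norm_scale: "x \<in> ncarrier E \<Longrightarrow> nnorm E (nscale E c x) = \<bar>c\<bar> * nnorm E x"
begin

lemma add_left_commute:
  "x \<in> ncarrier E \<Longrightarrow> y \<in> ncarrier E \<Longrightarrow> z \<in> ncarrier E \<Longrightarrow>
    nadd E x (nadd E y z) = nadd E y (nadd E x z)"
  by (metis add_assoc add_commute)

lemmas add_ac = add_assoc add_commute add_left_commute

lemma ndist_commute:
  assumes "x \<in> ncarrier E" "y \<in> ncarrier E"
  shows "ndist E x y = ndist E y x"
proof -
  have "nadd E x (nscale E (-1) y) = nscale E (-1) (nadd E y (nscale E (-1) x))"
    using assms by (simp add: scale_add_right add_commute)
  then show ?thesis
    using assms by (simp add: ndist_def norm_scale)
qed

lemma ndist_self:
  assumes "x \<in> ncarrier E"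
  shows "ndist E x x = 0"
proof -
  have "nadd E x (nscale E (-1) x) = nscale E 0 x"
    using scale_add_left[OF assms, of 1 "-1"] assms by simp
  then show ?thesis
    using assms by (simp add: ndist_def norm_scale)
qed

lemma ndist_triangle:
  assumes [simp]: "x \<in> ncarrier E" "y \<in> ncarrier E" "z \<in> ncarrier E"
  shows "ndist E x z \<le> ndist E x y + ndist E y z"
proof -
  have "nadd E (nscale E (-1) y) y = nscale E 0 y"
    using scale_add_left[of y "-1" 1] by simp
  then have "nadd E (nscale E (-1) y) (nadd E y (nscale E (-1) z)) = nscale E (-1) z"
    by (simp add: add_assoc[symmetric] add_commute[of "nscale E 0 y"] add_scale_zero)
  then have "nadd E x (nscale E (-1) z) =
      nadd E (nadd E x (nscale E (-1) y)) (nadd E y (nscale E (-1) z))"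
    by (simp add: add_assoc)
  then show ?thesis
    unfolding ndist_def by (metis add_closed assms norm_triangle scale_closed)
qed

lemma norm_nonneg:
  assumes [simp]: "x \<in> ncarrier E"
  shows "0 \<le> nnorm E x"
proof -
  have "0 = ndist E x x"
    by (simp add: ndist_self)
  also have "\<dots> \<le> nnorm E x + nnorm E (nscale E (-1) x)"
    unfolding ndist_def by (rule norm_triangle) simp_all
  finally show ?thesis
    by (simp add: norm_scale)
qed

lemma norm_le_ndist:
  assumes [simp]: "x \<in> ncarrier E" "y \<in> ncarrier E"
  shows "nnorm E x \<le> nnorm E y + ndist E x y"
proof -
  \<comment> \<open>The vector \<open>nscale E 0 x\<close> serves as the origin, so norms become
    distances to it.\<close>
  have z: "nnorm E v = ndist E v (nscale E 0 x)" if "v \<in> ncarrier E" for v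
    using that by (simp add: ndist_def add_scale_zero)
  show ?thesis
    using ndist_triangle[of x y "nscale E 0 x"] by (simp add: z)
qed

lemma dual_ndist:
  assumes "\<phi> \<in> dual_space E"
  obtains K where "K \<ge> 0" "\<And>x y. x \<in> ncarrier E \<Longrightarrow> y \<in> ncarrier E \<Longrightarrow> \<bar>\<phi> x - \<phi> y\<bar> \<le> K * ndist E x y"
proof -
  from assms obtain K where K: "\<forall>x\<in>ncarrier E. \<bar>\<phi> x\<bar> \<le> K * nnorm E x"
    unfolding dual_space_def by blast
  show ?thesis
  \<comment> \<open>The bound in \<open>dual_space\<close> carries no sign condition; its absolute
    value is a Lipschitz constant.\<close>
  proof (rule that[of "\<bar>K\<bar>"])
    fix x y assume xy: "x \<in> ncarrier E" "y \<in> ncarrier E"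
    then have "\<phi> x - \<phi> y = \<phi> (nadd E x (nscale E (-1) y))"
      using assms by (simp add: dual_space_def)
    moreover have "\<bar>\<dots>\<bar> \<le> K * ndist E x y"
      using K xy by (simp add: ndist_def)
    moreover have "K * ndist E x y \<le> \<bar>K\<bar> * ndist E x y"
      using xy by (intro mult_right_mono) (auto simp: ndist_def intro!: norm_nonneg)
    ultimately show "\<bar>\<phi> x - \<phi> y\<bar> \<le> \<bar>K\<bar> * ndist E x y"
      by linarith
  qed simp
qed

section \<open>Convex combinations and closed convex hulls\<close>

lemma scale_convex_self:
  assumes "x \<in> ncarrier E" "u + v = 1"
  shows "nadd E (nscale E u x) (nscale E v x) = x"
  using scale_add_left[OF assms(1), of u v] assms by simp

text \<open>When one pair of summands coincides, \<open>scale_convex_self\<close> contracts it, so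
  translations are affine. This is how convexity passes to translates of a convex set.\<close>

lemma convex_combination_add:
  assumes [simp]: "a \<in> ncarrier E" "b \<in> ncarrier E" "c \<in> ncarrier E" "d \<in> ncarrier E"
  shows "nadd E (nscale E u (nadd E a b)) (nscale E v (nadd E c d)) =
    nadd E (nadd E (nscale E u a) (nscale E v c)) (nadd E (nscale E u b) (nscale E v d))"
  by (simp add: scale_add_right add_ac)

lemma ndist_convex_combination:
  assumes [simp]: "x \<in> ncarrier E" "y \<in> ncarrier E" "x' \<in> ncarrier E" "y' \<in> ncarrier E"
    and "0 \<le> u" "0 \<le> v"
  shows "ndist E (nadd E (nscale E u x) (nscale E v y)) (nadd E (nscale E u x') (nscale E v y'))
    \<le> u * ndist E x x' + v * ndist E y y'"
proof -
  have "ndist E (nadd E (nscale E u x) (nscale E v y)) (nadd E (nscale E u x') (nscale E v y')) =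
    nnorm E (nadd E (nscale E u (nadd E x (nscale E (-1) x'))) (nscale E v (nadd E y (nscale E (-1) y'))))"
    unfolding ndist_def by (simp add: scale_add_right add_ac)
  also have "\<dots> \<le> u * ndist E x x' + v * ndist E y y'"
    unfolding ndist_def
    by (rule order_trans[OF norm_triangle]) (use assms(5,6) in \<open>simp_all add: norm_scale\<close>)
  finally show ?thesis .
qed

lemma ndist_add_right:
  assumes [simp]: "x \<in> ncarrier E" "y \<in> ncarrier E" "z \<in> ncarrier E"
  shows "ndist E (nadd E x z) (nadd E y z) \<le> ndist E x y"
proof -
  have "ndist E (nadd E x z) (nadd E y z) = ndist E (nadd E (nscale E 1 x) (nscale E 1 z)) (nadd E (nscale E 1 y) (nscale E 1 z))"
    by simp
  also have "\<dots> \<le> ndist E x y"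
    using ndist_convex_combination[of x z y z 1 1] by (simp add: ndist_self)
  finally show ?thesis .
qed

lemma convex_subset_unit_ball: "convex_subset E (unit_ball E)"
  unfolding convex_subset_def
proof (safe)
  fix x y and u v :: real
  assume xy: "x \<in> unit_ball E" "y \<in> unit_ball E" and uv: "0 \<le> u" "0 \<le> v" "u + v = 1"
  have "nnorm E (nadd E (nscale E u x) (nscale E v y)) \<le> u * nnorm E x + v * nnorm E y"
    by (rule order_trans[OF norm_triangle]) (use xy uv in \<open>simp_all add: norm_scale unit_ball_def\<close>)
  also have "\<dots> \<le> u * 1 + v * 1"
    using xy uv by (intro add_mono mult_left_mono) (auto simp: unit_ball_def)
  finally show "nadd E (nscale E u x) (nscale E v y) \<in> unit_ball E"
    using xy uv by (simp add: unit_ball_def)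
qed (auto simp: unit_ball_def)

lemma norm_closure_unit_ball: "norm_closure E (unit_ball E) \<subseteq> unit_ball E"
proof
  fix x assume x: "x \<in> norm_closure E (unit_ball E)"
  then have xE: "x \<in> ncarrier E"
    by (simp add: norm_closure_def)
  have "nnorm E x \<le> 1 + e" if "e > 0" for e
  proof -
    from x that obtain y where "y \<in> unit_ball E" "ndist E x y < e"
      unfolding norm_closure_def by blast
    then show ?thesis
      using norm_le_ndist[OF xE, of y] by (simp add: unit_ball_def)
  qed
  then have "nnorm E x \<le> 1"
    by (rule field_le_epsilon)
  with xE show "x \<in> unit_ball E"
    by (simp add: unit_ball_def)
qed

lemma convex_subset_hull:
  assumes "S \<subseteq> ncarrier E"
  shows "convex_subset E (convex_subset E hull S)"
proof -
  \<comment> \<open>The hull is an intersection of convex subsets of the carrier; exhibiting the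
    carrier as one of them keeps the hull inside it.\<close>
  have "convex_subset E (ncarrier E)"
    by (auto simp: convex_subset_def)
  then have "convex_subset E hull S \<subseteq> ncarrier E"
    by (intro hull_minimal assms)
  then show ?thesis
    by (auto simp: convex_subset_def hull_def)
qed

lemma norm_closure_extensive: "S \<subseteq> ncarrier E \<Longrightarrow> S \<subseteq> norm_closure E S"
  by (auto simp: norm_closure_def intro!: bexI simp: ndist_self)

lemma norm_closure_mono: "S \<subseteq> S' \<Longrightarrow> norm_closure E S \<subseteq> norm_closure E S'"
  unfolding norm_closure_def by blast

lemma norm_closure_idem:
  assumes "S \<subseteq> ncarrier E"
  shows "norm_closure E (norm_closure E S) \<subseteq> norm_closure E S"
proof
  fix x assume x: "x \<in> norm_closure E (norm_closure E S)"
  then have xE: "x \<in> ncarrier E"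
    by (simp add: norm_closure_def)
  have "\<exists>z\<in>S. ndist E x z < e" if "e > 0" for e
  proof -
    have e: "e / 2 > 0"
      using that by simp
    then obtain y where y: "y \<in> norm_closure E S" "ndist E x y < e / 2"
      using x unfolding norm_closure_def[of E "norm_closure E S"] by blast
    then obtain z where z: "z \<in> S" "ndist E y z < e / 2"
      using e unfolding norm_closure_def by blast
    have "ndist E x z \<le> ndist E x y + ndist E y z"
      using xE y(1) z(1) assms by (intro ndist_triangle) (auto simp: norm_closure_def)
    with y z show ?thesis
      by (intro bexI[of _ z]) auto
  qed
  with xE show "x \<in> norm_closure E S"
    by (simp add: norm_closure_def)
qed

lemma convex_subset_norm_closure:
  assumes "convex_subset E S"
  shows "convex_subset E (norm_closure E S)"
  unfolding convex_subset_def
proof safe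
  fix x y and u v :: real
  assume xy: "x \<in> norm_closure E S" "y \<in> norm_closure E S" and uv: "0 \<le> u" "0 \<le> v" "u + v = 1"
  then have xyE: "x \<in> ncarrier E" "y \<in> ncarrier E"
    by (auto simp: norm_closure_def)
  have "\<exists>z\<in>S. ndist E (nadd E (nscale E u x) (nscale E v y)) z < e" if e: "e > 0" for e
  proof -
    obtain x' y' where x'y': "x' \<in> S" "ndist E x x' < e" "y' \<in> S" "ndist E y y' < e"
      using xy e unfolding norm_closure_def by blast
    then have "nadd E (nscale E u x') (nscale E v y') \<in> S" and E: "x' \<in> ncarrier E" "y' \<in> ncarrier E"
      using assms uv unfolding convex_subset_def by auto
    moreover have "ndist E (nadd E (nscale E u x) (nscale E v y)) (nadd E (nscale E u x') (nscale E v y'))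
        \<le> u * ndist E x x' + v * ndist E y y'"
      using xyE E uv by (intro ndist_convex_combination)
    moreover have "u * ndist E x x' + v * ndist E y y' < e"
      using uv x'y' by (intro convex_bound_lt) auto
    ultimately show ?thesis
      by (meson le_less_trans)
  qed
  then show "nadd E (nscale E u x) (nscale E v y) \<in> norm_closure E S"
    using xyE by (simp add: norm_closure_def)
qed (auto simp: norm_closure_def)

lemma closed_conv_facts:
  assumes "S \<subseteq> ncarrier E"
  shows "convex_subset E (closed_conv E S)" "norm_closure E (closed_conv E S) \<subseteq> closed_conv E S"
    "S \<subseteq> closed_conv E S"
proof -
  note c = convex_subset_hull[OF assms]
  then have sub: "convex_subset E hull S \<subseteq> ncarrier E"
    by (simp add: convex_subset_def)
  show "convex_subset E (closed_conv E S)"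
    unfolding closed_conv_def by (rule convex_subset_norm_closure[OF c])
  show "norm_closure E (closed_conv E S) \<subseteq> closed_conv E S"
    unfolding closed_conv_def by (rule norm_closure_idem[OF sub])
  show "S \<subseteq> closed_conv E S"
    unfolding closed_conv_def
    using norm_closure_extensive[OF sub] hull_subset[of S "convex_subset E"] by (rule order_trans[rotated])
qed

text \<open>Together with \<open>closed_conv_facts\<close> this makes \<open>closed_conv E S\<close>
  the least closed convex superset of \<open>S\<close>, and later arguments use it only in this
  form.\<close>

lemma closed_conv_minimal:
  assumes "S \<subseteq> K" "convex_subset E K" "norm_closure E K \<subseteq> K"
  shows "closed_conv E S \<subseteq> K"
  unfolding closed_conv_def
  using norm_closure_mono[OF hull_minimal[where S = "convex_subset E", OF assms(1,2)]] assms(3)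
  by (rule order_trans)

end

section \<open>Bounded operators from X into E and their finite sums\<close>

definition bounded_operator :: "'v nspace \<Rightarrow> ('a::real_normed_vector \<Rightarrow> 'v) \<Rightarrow> bool" where
  "bounded_operator E T \<longleftrightarrow> (\<forall>x. T x \<in> ncarrier E) \<and>
     (\<forall>x y. T (x + y) = nadd E (T x) (T y)) \<and> (\<forall>c x. T (c *\<^sub>R x) = nscale E c (T x)) \<and>
     (\<exists>K. \<forall>x. nnorm E (T x) \<le> K * norm x)"

text \<open>Recursion takes the place of a finite sum, because addition in E is a record field and
  not a type class operation.\<close>

primrec operator_sum ::
  "'v nspace \<Rightarrow> 'v \<Rightarrow> (nat \<Rightarrow> 'a \<Rightarrow> 'v) \<Rightarrow> (nat \<Rightarrow> 'a) \<Rightarrow> nat \<Rightarrow> 'v" where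
  "operator_sum E r T z 0 = r"
| "operator_sum E r T z (Suc m) = nadd E (operator_sum E r T z m) (T m (z m))"

text \<open>Pulling a functional back along \<open>T\<close> moves a slice or weak neighbourhood of
  E to X, where the hypothesis on X can be applied.\<close>

lemma (in normed_nspace) bounded_linear_dual_comp:
  assumes T: "bounded_operator E T" and \<phi>: "\<phi> \<in> dual_space E"
  shows "bounded_linear (\<lambda>x. \<phi> (T x))"
proof -
  obtain K where K: "\<forall>x\<in>ncarrier E. \<bar>\<phi> x\<bar> \<le> K * nnorm E x"
    using \<phi> unfolding dual_space_def by blast
  obtain L where L: "\<forall>x. nnorm E (T x) \<le> L * norm x"
    using T unfolding bounded_operator_def by blast
  show ?thesis
  proof (rule bounded_linear_intro[where K = "\<bar>K\<bar> * L"])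
    fix x
    have "\<bar>\<phi> (T x)\<bar> \<le> K * nnorm E (T x)"
      using K T by (simp add: bounded_operator_def)
    also have "\<dots> \<le> \<bar>K\<bar> * nnorm E (T x)"
      using T by (intro mult_right_mono norm_nonneg) (auto simp: bounded_operator_def)
    also have "\<dots> \<le> \<bar>K\<bar> * (L * norm x)"
      using L by (intro mult_left_mono) auto
    finally show "norm (\<phi> (T x)) \<le> norm x * (\<bar>K\<bar> * L)"
      by (simp add: mult_ac)
  qed (use T \<phi> in \<open>auto simp: bounded_operator_def dual_space_def\<close>)
qed


lemma (in normed_nspace) operator_sum_closed:
  assumes "r \<in> ncarrier E" "\<And>i. i < m \<Longrightarrow> bounded_operator E (T i)"
  shows "operator_sum E r T z m \<in> ncarrier E"
  using assms(2) by (induction m) (use assms(1) in \<open>auto simp: bounded_operator_def\<close>)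

text \<open>A functional sees the arguments \<open>z i\<close> separately, so each may be replaced
  on its own and the errors merely add up.\<close>

lemma (in normed_nspace) dual_operator_sum:
  assumes \<phi>: "\<phi> \<in> dual_space E" and r: "r \<in> ncarrier E"
    and "\<And>i. i < m \<Longrightarrow> bounded_operator E (T i)"
  shows "\<phi> (operator_sum E r T z m) = \<phi> r + (\<Sum>i<m. \<phi> (T i (z i)))"
  using assms(3)
proof (induction m)
  case (Suc m)
  have "operator_sum E r T z m \<in> ncarrier E"
    by (rule operator_sum_closed[OF r]) (use Suc.prems in auto)
  with Suc \<phi> show ?case
    by (simp add: dual_space_def bounded_operator_def)
qed simp

text \<open>
  The factors are enlarged one at a time: if all other arguments are fixed, the values of the
  remaining one for which the sum lies in \<open>K\<close> form a closed convex set.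
\<close>

lemma (in normed_nspace) operator_sum_closed_convex:
  fixes T :: "nat \<Rightarrow> 'a::real_normed_vector \<Rightarrow> 'v"
  assumes "convex_subset E K" "norm_closure E K \<subseteq> K"
    and "r \<in> ncarrier E" "\<And>i. i < m \<Longrightarrow> bounded_operator E (T i)"
    and "\<And>z. (\<And>i. i < m \<Longrightarrow> z i \<in> S i) \<Longrightarrow> operator_sum E r T z m \<in> K"
    and "\<And>i. i < m \<Longrightarrow> z i \<in> closure (convex hull S i)"
  shows "operator_sum E r T z m \<in> K"
  using assms
proof (induction m arbitrary: K)
  case 0
  then show ?case by simp
next
  case (Suc m)
  note op = Suc.prems(4)
  have Tm: "bounded_operator E (T m)"
    using op by simp
  have Tm_closed [simp]: "T m x \<in> ncarrier E" for x
    using Tm by (simp add: bounded_operator_def)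
  have conv: "nadd E (nscale E u a) (nscale E v b) \<in> K"
    if "a \<in> K" "b \<in> K" "0 \<le> u" "0 \<le> v" "u + v = 1" for a b u v
    using Suc.prems(1) that by (simp add: convex_subset_def)
  have closed: "x \<in> K" if "x \<in> ncarrier E" "\<And>e. e > 0 \<Longrightarrow> \<exists>y\<in>K. ndist E x y < e" for x
    using Suc.prems(2) that by (auto simp: norm_closure_def)
  \<comment> \<open>First the last argument is frozen at a point \<open>s\<close> of
    \<open>S m\<close>. The induction hypothesis, applied to the translate of \<open>K\<close> by
    \<open>T m s\<close>, enlarges the other arguments.\<close>
  have *: "operator_sum E r T z m \<in> {e \<in> ncarrier E. nadd E e (T m s) \<in> K}" if s: "s \<in> S m" for s
  proof (rule Suc.IH)
    show "convex_subset E {e \<in> ncarrier E. nadd E e (T m s) \<in> K}"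
      unfolding convex_subset_def
    proof (safe)
      fix a b and u v :: real
      assume ab: "a \<in> ncarrier E" "b \<in> ncarrier E" "nadd E a (T m s) \<in> K" "nadd E b (T m s) \<in> K"
        and uv: "0 \<le> u" "0 \<le> v" "u + v = 1"
      have "nadd E (nadd E (nscale E u a) (nscale E v b)) (T m s) =
          nadd E (nscale E u (nadd E a (T m s))) (nscale E v (nadd E b (T m s)))"
        using ab uv by (simp add: convex_combination_add scale_convex_self)
      also have "\<dots> \<in> K"
        using ab uv by (intro conv)
      finally show "nadd E (nadd E (nscale E u a) (nscale E v b)) (T m s) \<in> K" .
    qed auto
    show "norm_closure E {e \<in> ncarrier E. nadd E e (T m s) \<in> K} \<subseteq> {e \<in> ncarrier E. nadd E e (T m s) \<in> K}"
    proof
      fix x assume x: "x \<in> norm_closure E {e \<in> ncarrier E. nadd E e (T m s) \<in> K}"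
      then have [simp]: "x \<in> ncarrier E"
        by (simp add: norm_closure_def)
      have "nadd E x (T m s) \<in> K"
      proof (rule closed)
        fix e :: real assume "e > 0"
        then obtain y where y: "y \<in> ncarrier E" "nadd E y (T m s) \<in> K" "ndist E x y < e"
          using x by (auto simp: norm_closure_def)
        then have "ndist E (nadd E x (T m s)) (nadd E y (T m s)) < e"
          using ndist_add_right[of x y "T m s"] by simp
        with y show "\<exists>y\<in>K. ndist E (nadd E x (T m s)) y < e"
          by blast
      qed simp
      then show "x \<in> {e \<in> ncarrier E. nadd E e (T m s) \<in> K}"
        by simp
    qed
    fix z assume z: "\<And>i. i < m \<Longrightarrow> z i \<in> S i"
    have "operator_sum E r T (z(m := s)) (Suc m) \<in> K"
      by (rule Suc.prems(5)) (use z s in \<open>auto simp: less_Suc_eq\<close>)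
    \<comment> \<open>Index \<open>m\<close> is first read in the sum of length
      \<open>Suc m\<close>, so overwriting it leaves shorter sums unchanged.\<close>
    moreover have "operator_sum E r T (z(m := s)) k = operator_sum E r T z k" if "k \<le> m" for k
      using that by (induction k) auto
    moreover have "operator_sum E r T z m \<in> ncarrier E"
      by (rule operator_sum_closed[OF Suc.prems(3)]) (use op in auto)
    ultimately show "operator_sum E r T z m \<in> {e \<in> ncarrier E. nadd E e (T m s) \<in> K}"
      by simp
  qed (use Suc.prems(3,6) op in auto)
  \<comment> \<open>Now the first \<open>m\<close> arguments are fixed, and the last one moves from
    \<open>S m\<close> to its closed convex hull, since the preimage of \<open>K\<close> under
    \<open>x \<mapsto> e + T m x\<close> is closed and convex.\<close>
  define e where "e = operator_sum E r T z m"
  have [simp]: "e \<in> ncarrier E"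
    unfolding e_def by (rule operator_sum_closed[OF Suc.prems(3)]) (use op in auto)
  obtain C where C: "nnorm E (T m x) \<le> C * norm x" for x
    using Tm unfolding bounded_operator_def by blast
  have "closure (convex hull S m) \<subseteq> {x. nadd E e (T m x) \<in> K}"
  proof (rule closure_minimal[OF hull_minimal])
    show "S m \<subseteq> {x. nadd E e (T m x) \<in> K}"
      using * by (auto simp: e_def)
    show "convex {x. nadd E e (T m x) \<in> K}"
    proof (rule convexI, clarsimp)
      fix x y and u v :: real
      assume "nadd E e (T m x) \<in> K" "nadd E e (T m y) \<in> K" and uv: "0 \<le> u" "0 \<le> v" "u + v = 1"
      then have "nadd E (nscale E u (nadd E e (T m x))) (nscale E v (nadd E e (T m y))) \<in> K"
        by (intro conv)
      then show "nadd E e (T m (u *\<^sub>R x + v *\<^sub>R y)) \<in> K"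
        using Tm uv by (simp add: convex_combination_add scale_convex_self bounded_operator_def)
    qed
    show "closed {x. nadd E e (T m x) \<in> K}"
      unfolding closed_sequential_limits
    proof (clarify)
      fix xs l assume xs: "\<forall>n. xs n \<in> {x. nadd E e (T m x) \<in> K}" "xs \<longlonglongrightarrow> l"
      have "nadd E e (T m l) \<in> K"
      proof (rule closed)
        fix d :: real assume "d > 0"
        have "(\<lambda>n. C * norm (l - xs n)) \<longlonglongrightarrow> C * norm (l - l)"
          by (intro tendsto_intros xs)
        then have "eventually (\<lambda>n. C * norm (l - xs n) < d) sequentially"
          using \<open>d > 0\<close> by (intro order_tendstoD) auto
        then obtain n where n: "C * norm (l - xs n) < d"
          by (auto simp: eventually_sequentially)
        have "ndist E (nadd E e (T m l)) (nadd E e (T m (xs n))) \<le> ndist E (T m l) (T m (xs n))"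
          using ndist_add_right[of "T m l" "T m (xs n)" e] by (simp add: add_commute)
        also have "\<dots> = nnorm E (T m (l + (-1) *\<^sub>R xs n))"
          using Tm unfolding bounded_operator_def ndist_def by metis
        also have "\<dots> \<le> C * norm (l - xs n)"
          using C[of "l + (-1) *\<^sub>R xs n"] by simp
        also note n
        finally show "\<exists>y\<in>K. ndist E (nadd E e (T m l)) y < d"
          using xs(1) by blast
      qed simp
      then show "nadd E e (T m l) \<in> K" .
    qed
  qed
  with Suc.prems(6)[of m] show ?case
    by (auto simp: e_def)
qed


section \<open>Transfer of diametral properties\<close>

text \<open>Common form of two properties: with \<open>F\<close> ranging over finite sets of
  functionals it expresses the DD2P, over singletons the DLD2P. The bounds on functionals are
  one-sided because \<open>F\<close> may contain negatives as well.\<close>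

definition diametral :: "'v nspace \<Rightarrow> ('v \<Rightarrow> real) set \<Rightarrow> bool" where
  "diametral E F \<longleftrightarrow> (\<forall>x\<in>unit_sphere E. \<forall>\<epsilon>>0. \<exists>y\<in>unit_ball E.
     2 - \<epsilon> \<le> ndist E x y \<and> (\<forall>\<phi>\<in>F. \<phi> x - \<epsilon> < \<phi> y))"

section \<open>Weak neighbourhoods and slices in terms of functionals\<close>

context normed_nspace
begin

text \<open>Induction on how \<open>W\<close> is generated: an intersection takes the union of the
  functionals and the smaller radius, a union inherits the data of one member.\<close>

lemma weak_neighbourhood:
  assumes "openin (weak_topology E) W" "x \<in> W"
  obtains F \<delta> where "finite F" "F \<subseteq> dual_space E" "\<delta> > 0"
    "{y \<in> ncarrier E. \<forall>\<phi>\<in>F. \<phi> x - \<delta> < \<phi> y} \<subseteq> W"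
proof -
  let ?N = "\<lambda>F \<delta>. {y \<in> ncarrier E. \<forall>\<phi>\<in>F. \<phi> x - \<delta> < \<phi> y}"
  have "generate_topology_on {{x \<in> ncarrier E. \<phi> x \<in> V} | \<phi> V. \<phi> \<in> dual_space E \<and> open V} W"
    using assms(1) unfolding weak_topology_def by (rule openin_topology_generated_by)
  then have "x \<in> W \<longrightarrow> (\<exists>F \<delta>. finite F \<and> F \<subseteq> dual_space E \<and> \<delta> > 0 \<and> ?N F \<delta> \<subseteq> W)"
  proof (induction rule: generate_topology_on.induct)
    case Empty
    then show ?case by simp
  next
    case (Int a b)
    show ?case
    proof
      assume "x \<in> a \<inter> b"
      with Int obtain F \<delta> F' \<delta>' where F: "finite F" "F \<subseteq> dual_space E" "\<delta> > 0" "?N F \<delta> \<subseteq> a"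
        and F': "finite F'" "F' \<subseteq> dual_space E" "\<delta>' > 0" "?N F' \<delta>' \<subseteq> b"
        by auto
      have "?N (F \<union> F') (min \<delta> \<delta>') \<subseteq> ?N F \<delta> \<inter> ?N F' \<delta>'"
      proof (intro subsetI IntI CollectI conjI ballI)
        fix y \<phi> assume "y \<in> ?N (F \<union> F') (min \<delta> \<delta>')"
        then have y: "\<phi> x - min \<delta> \<delta>' < \<phi> y" if "\<phi> \<in> F \<union> F'"
          using that by simp
        show "\<phi> x - \<delta> < \<phi> y" if "\<phi> \<in> F"
          using y that by simp
        show "\<phi> x - \<delta>' < \<phi> y" if "\<phi> \<in> F'"
          using y that by simp
      qed auto
      then have "?N (F \<union> F') (min \<delta> \<delta>') \<subseteq> a \<inter> b"
        by (rule subset_trans) (rule Int_mono[OF F(4) F'(4)])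
      moreover have "finite (F \<union> F')" "F \<union> F' \<subseteq> dual_space E" "0 < min \<delta> \<delta>'"
        using F(1-3) F'(1-3) by simp_all
      ultimately show "\<exists>F \<delta>. finite F \<and> F \<subseteq> dual_space E \<and> \<delta> > 0 \<and> ?N F \<delta> \<subseteq> a \<inter> b"
        by meson
    qed
  next
    case (UN K)
    show ?case
    proof
      assume "x \<in> \<Union>K"
      then obtain k where k: "k \<in> K" "x \<in> k"
        by blast
      obtain F \<delta> where "finite F" "F \<subseteq> dual_space E" "\<delta> > 0" and F: "?N F \<delta> \<subseteq> k"
        using mp[OF UN.IH[OF k(1)] k(2)] by (elim exE conjE)
      moreover have "?N F \<delta> \<subseteq> \<Union>K"
        using F by (rule subset_trans) (rule Union_upper[OF k(1)])
      ultimately show "\<exists>F \<delta>. finite F \<and> F \<subseteq> dual_space E \<and> \<delta> > 0 \<and> ?N F \<delta> \<subseteq> \<Union>K"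
        by meson
    qed
  next
    case (Basis s)
    then obtain \<phi> V where s: "s = {x \<in> ncarrier E. \<phi> x \<in> V}" and \<phi>: "\<phi> \<in> dual_space E" and "open V"
      by blast
    show ?case
    proof
      assume x: "x \<in> s"
      then obtain e where e: "e > 0" "\<And>t. dist t (\<phi> x) < e \<Longrightarrow> t \<in> V"
        using \<open>open V\<close> unfolding s by (auto simp: open_dist)
      \<comment> \<open>The negative supplies the upper bound, which turns the one-sided condition
        into an interval around \<open>\<phi> x\<close>.\<close>
      have "(\<lambda>x. - \<phi> x) \<in> dual_space E"
        using \<phi> by (simp add: dual_space_def)
      moreover have "?N {\<phi>, \<lambda>x. - \<phi> x} e \<subseteq> s"
      proof
        fix y assume "y \<in> ?N {\<phi>, \<lambda>x. - \<phi> x} e"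
        then have "y \<in> ncarrier E" "\<bar>\<phi> y - \<phi> x\<bar> < e"
          by auto
        then show "y \<in> s"
          by (simp add: s e(2) dist_real_def)
      qed
      moreover from calculation \<phi> have "finite {\<phi>, \<lambda>x. - \<phi> x}" "{\<phi>, \<lambda>x. - \<phi> x} \<subseteq> dual_space E"
        by simp_all
      ultimately show "\<exists>F \<delta>. finite F \<and> F \<subseteq> dual_space E \<and> \<delta> > 0 \<and> ?N F \<delta> \<subseteq> s"
        by (iprover intro: exI conjI e(1))
    qed
  qed
  from mp[OF this assms(2)] show ?thesis
    by (elim exE conjE) (rule that)
qed

lemma openin_weak_topology_halfspaces:
  assumes "finite F" "F \<subseteq> dual_space E"
  shows "openin (weak_topology E) {y \<in> ncarrier E. \<forall>\<phi>\<in>F. c \<phi> < \<phi> y}"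
  using assms
proof (induction rule: finite_induct)
  case empty
  \<comment> \<open>The whole carrier is open because it is the preimage of \<open>UNIV\<close>
    under the zero functional.\<close>
  have "(\<lambda>_. 0) \<in> dual_space E"
    by (auto simp: dual_space_def intro: exI[of _ 0])
  then have "openin (weak_topology E) {y \<in> ncarrier E. (0::real) \<in> UNIV}"
    unfolding weak_topology_def by (intro topology_generated_by_Basis) blast
  then show ?case
    by simp
next
  case (insert \<phi> F)
  have "openin (weak_topology E) {y \<in> ncarrier E. \<phi> y \<in> {c \<phi><..}}"
    unfolding weak_topology_def
  proof (rule topology_generated_by_Basis, rule CollectI, intro exI conjI)
    show "\<phi> \<in> dual_space E"
      using insert.prems by simp
  qed (rule refl, rule open_greaterThan)
  moreover have "{y \<in> ncarrier E. \<forall>\<psi>\<in>insert \<phi> F. c \<psi> < \<psi> y} =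
      {y \<in> ncarrier E. \<phi> y \<in> {c \<phi><..}} \<inter> {y \<in> ncarrier E. \<forall>\<psi>\<in>F. c \<psi> < \<psi> y}"
    by auto
  ultimately show ?case
    using insert by (auto intro: openin_Int)
qed

lemma DD2P_iff_diametral:
  "DD2P E \<longleftrightarrow> (\<forall>F. finite F \<longrightarrow> F \<subseteq> dual_space E \<longrightarrow> diametral E F)"
proof (intro iffI allI impI)
  fix F assume DD2P: "DD2P E" and F: "finite F" "F \<subseteq> dual_space E"
  show "diametral E F"
    unfolding diametral_def
  proof (intro ballI allI impI)
    fix x and \<epsilon> :: real assume x: "x \<in> unit_sphere E" and "\<epsilon> > 0"
    let ?U = "unit_ball E \<inter> {y \<in> ncarrier E. \<forall>\<phi>\<in>F. \<phi> x - \<epsilon> < \<phi> y}"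
    have "openin (subtopology (weak_topology E) (unit_ball E)) ?U"
      by (rule openin_subtopology_Int2[OF openin_weak_topology_halfspaces[OF F]])
    moreover have "x \<in> ?U \<inter> unit_sphere E"
      using x \<open>\<epsilon> > 0\<close> by (auto simp: unit_ball_def unit_sphere_def)
    ultimately obtain y where "y \<in> ?U" "ndist E x y \<ge> 2 - \<epsilon>"
      using DD2P \<open>\<epsilon> > 0\<close> unfolding DD2P_def by blast
    then show "\<exists>y\<in>unit_ball E. 2 - \<epsilon> \<le> ndist E x y \<and> (\<forall>\<phi>\<in>F. \<phi> x - \<epsilon> < \<phi> y)"
      by blast
  qed
next
  assume diametral: "\<forall>F. finite F \<longrightarrow> F \<subseteq> dual_space E \<longrightarrow> diametral E F"
  show "DD2P E"
    unfolding DD2P_def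
  proof (intro allI impI ballI, elim conjE)
    fix U x and \<epsilon> :: real
    assume U: "openin (subtopology (weak_topology E) (unit_ball E)) U"
      and x: "x \<in> U \<inter> unit_sphere E" and \<epsilon>: "\<epsilon> > 0"
    from U obtain W where W: "openin (weak_topology E) W" "U = W \<inter> unit_ball E"
      by (auto simp: openin_subtopology)
    with x obtain F \<delta> where F: "finite F" "F \<subseteq> dual_space E" "\<delta> > 0"
      "{y \<in> ncarrier E. \<forall>\<phi>\<in>F. \<phi> x - \<delta> < \<phi> y} \<subseteq> W"
      by (auto elim: weak_neighbourhood)
    have "diametral E F"
      using diametral F by blast
    \<comment> \<open>The minimum serves both demands: distance at least
      \<open>2 - \<epsilon>\<close> and membership in the neighbourhood of radius
      \<open>\<delta>\<close>.\<close>
    then obtain y where y: "y \<in> unit_ball E" "2 - min \<epsilon> \<delta> \<le> ndist E x y"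
      "\<forall>\<phi>\<in>F. \<phi> x - min \<epsilon> \<delta> < \<phi> y"
      using x \<epsilon> \<open>\<delta> > 0\<close> unfolding diametral_def by (meson IntD2 min_less_iff_conj)
    have "y \<in> W"
      using F(4) y by (force simp: unit_ball_def)
    with y W show "\<exists>y\<in>U. 2 - \<epsilon> \<le> ndist E x y"
      by (intro bexI[of _ y]) auto
  qed
qed

text \<open>A real supremum bounds its set only once that set is known to be bounded above, which
  here follows from the bound in \<open>dual_space\<close>.\<close>

lemma dual_norm_upper:
  assumes "\<phi> \<in> dual_space E" "x \<in> unit_ball E"
  shows "\<bar>\<phi> x\<bar> \<le> dual_norm E \<phi>"
proof -
  obtain K where K: "\<forall>x\<in>ncarrier E. \<bar>\<phi> x\<bar> \<le> K * nnorm E x"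
    using assms(1) unfolding dual_space_def by blast
  have "\<bar>\<phi> x\<bar> \<le> \<bar>K\<bar>" if "x \<in> unit_ball E" for x
  proof -
    have x: "x \<in> ncarrier E" "nnorm E x \<le> 1"
      using that by (auto simp: unit_ball_def)
    have "\<bar>\<phi> x\<bar> \<le> K * nnorm E x"
      using K x by simp
    also have "\<dots> \<le> \<bar>K\<bar> * 1"
      using x norm_nonneg[of x] by (intro mult_mono) auto
    finally show ?thesis by simp
  qed
  then have "bdd_above ((\<lambda>x. \<bar>\<phi> x\<bar>) ` unit_ball E)"
    by (intro bdd_aboveI2) 
  then show ?thesis
    unfolding dual_norm_def using assms(2) by (rule cSUP_upper2) simp
qed

text \<open>A nonzero functional is divided by its norm to reach the dual sphere, and
  \<open>\<alpha>\<close> is then adjusted so that the slice is the wanted half-space.\<close>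

lemma DLD2P_iff_diametral: "DLD2P E \<longleftrightarrow> (\<forall>\<phi>\<in>dual_space E. diametral E {\<phi>})"
proof (intro iffI ballI)
  fix \<phi> assume DLD2P: "DLD2P E" and \<phi>: "\<phi> \<in> dual_space E"
  show "diametral E {\<phi>}"
    unfolding diametral_def
  proof (intro ballI allI impI)
    fix x and \<epsilon> :: real assume x: "x \<in> unit_sphere E" and "\<epsilon> > 0"
    then have xE [simp]: "x \<in> ncarrier E" "nnorm E x = 1" and xB: "x \<in> unit_ball E"
      by (auto simp: unit_sphere_def unit_ball_def)
    define c where "c = dual_norm E \<phi>"
    have c: "\<bar>\<phi> y\<bar> \<le> c" if "y \<in> unit_ball E" for y
      unfolding c_def using \<phi> that by (rule dual_norm_upper)
    show "\<exists>y\<in>unit_ball E. 2 - \<epsilon> \<le> ndist E x y \<and> (\<forall>\<phi>\<in>{\<phi>}. \<phi> x - \<epsilon> < \<phi> y)"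
    proof (cases "c = 0")
      case True
      \<comment> \<open>A functional that vanishes on the ball puts no constraint on
        \<open>y\<close>, so the antipode, at distance 2, serves.\<close>
      define y where "y = nscale E (-1) x"
      have y: "y \<in> unit_ball E"
        by (simp add: y_def unit_ball_def norm_scale)
      have "ndist E x y = nnorm E (nadd E (nscale E 1 x) (nscale E 1 x))"
        by (simp add: ndist_def y_def)
      also have "\<dots> = 2"
        by (subst scale_add_left[symmetric]) (simp_all add: norm_scale)
      finally show ?thesis
        using c[OF y] c[OF xB] True y \<open>\<epsilon> > 0\<close> by (intro bexI[of _ y]) auto
    next
      case False
      with c[OF xB] have c0: "c > 0"
        by linarith
      define \<psi> where "\<psi> y = \<phi> y / c" for y
      have \<psi>: "\<psi> \<in> dual_space E"
      proof -
        obtain K where K: "\<forall>x\<in>ncarrier E. \<bar>\<phi> x\<bar> \<le> K * nnorm E x"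
          using \<phi> unfolding dual_space_def by blast
        have "\<bar>\<psi> x\<bar> \<le> (K / c) * nnorm E x" if "x \<in> ncarrier E" for x
          using K that c0 by (simp add: \<psi>_def divide_right_mono)
        then have "\<exists>K. \<forall>x\<in>ncarrier E. \<bar>\<psi> x\<bar> \<le> K * nnorm E x"
          by blast
        then show ?thesis
          using \<phi> by (simp add: dual_space_def \<psi>_def add_divide_distrib)
      qed
      have "dual_norm E \<psi> = 1"
      proof (rule antisym)
        show "dual_norm E \<psi> \<le> 1"
          unfolding dual_norm_def
          by (rule cSUP_least) (use xB c c0 in \<open>auto simp: \<psi>_def\<close>)
        have "c \<le> c * dual_norm E \<psi>"
        proof (subst (1) c_def, unfold dual_norm_def[of E \<phi>], rule cSUP_least)
          fix y assume "y \<in> unit_ball E"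
          then have "\<bar>\<psi> y\<bar> \<le> dual_norm E \<psi>"
            by (rule dual_norm_upper[OF \<psi>])
          then show "\<bar>\<phi> y\<bar> \<le> c * dual_norm E \<psi>"
            using c0 by (simp add: \<psi>_def field_simps)
        qed (use xB in auto)
        then show "1 \<le> dual_norm E \<psi>"
          using c0 by simp
      qed
      with \<psi> have \<psi>: "\<psi> \<in> dual_sphere E"
        by (simp add: dual_sphere_def)
      \<comment> \<open>With this value, \<open>\<psi> y > 1 - \<alpha>\<close> says exactly
        \<open>\<phi> y > \<phi> x - \<epsilon>\<close>.\<close>
      define \<alpha> where "\<alpha> = 1 - (\<phi> x - \<epsilon>) / c"
      have "(\<phi> x - \<epsilon>) / c < 1"
        using c0 c[OF xB] \<open>\<epsilon> > 0\<close> by (simp add: field_simps)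
      then have "\<alpha> > 0"
        by (simp add: \<alpha>_def)
      moreover have "x \<in> slice E \<psi> \<alpha> \<inter> unit_sphere E"
        using x xB c0 \<open>\<epsilon> > 0\<close> by (simp add: slice_def \<psi>_def \<alpha>_def divide_strict_right_mono)
      ultimately obtain y where "y \<in> slice E \<psi> \<alpha>" "ndist E x y \<ge> 2 - \<epsilon>"
        using DLD2P \<psi> \<open>\<epsilon> > 0\<close> unfolding DLD2P_def by blast
      then show ?thesis
        using c0 by (auto simp: slice_def \<psi>_def \<alpha>_def divide_less_cancel)
    qed
  qed
next
  assume diametral: "\<forall>\<phi>\<in>dual_space E. diametral E {\<phi>}"
  show "DLD2P E"
    unfolding DLD2P_def
  proof (intro ballI allI impI)
    fix \<phi> x and \<alpha> \<epsilon> :: real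
    assume \<phi>: "\<phi> \<in> dual_sphere E" and x: "x \<in> slice E \<phi> \<alpha> \<inter> unit_sphere E" and \<epsilon>: "\<epsilon> > 0"
    \<comment> \<open>The second term is the depth of \<open>x\<close> inside the slice; losing less
      than that keeps \<open>y\<close> in the slice.\<close>
    define \<delta> where "\<delta> = min \<epsilon> (\<phi> x - (1 - \<alpha>))"
    have "\<delta> > 0"
      using x \<epsilon> by (simp add: \<delta>_def slice_def)
    moreover have "diametral E {\<phi>}"
      using diametral \<phi> by (simp add: dual_sphere_def)
    ultimately obtain y where "y \<in> unit_ball E" "2 - \<delta> \<le> ndist E x y" "\<phi> x - \<delta> < \<phi> y"
      using x unfolding diametral_def by blast
    then show "\<exists>y\<in>slice E \<phi> \<alpha>. 2 - \<epsilon> \<le> ndist E x y"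
      by (intro bexI[of _ y]) (auto simp: slice_def \<delta>_def min_def split: if_splits)
  qed
qed

end

section \<open>Passing from X to spaces approximated by directional sums\<close>

interpretation space_of: normed_nspace "space_of T"
  by unfold_locales (simp_all add: algebra_simps norm_triangle_ineq)

text \<open>
  In the application \<open>operator_sum E r T z m\<close> is \<open>r + (\<Sum>i<m. 1\<^bsub>A i\<^esub> \<parallel>v i\<parallel> z i)\<close>, where \<open>r\<close> vanishes on the
  disjoint sets \<open>A i\<close>: a function with value \<open>v i\<close> on \<open>A i\<close> is varied by changing the directions
  \<open>v i / \<parallel>v i\<parallel>\<close> only.
\<close>

definition directional_sum ::
  "'v nspace \<Rightarrow> 'v \<Rightarrow> (nat \<Rightarrow> 'a::real_normed_vector \<Rightarrow> 'v) \<Rightarrow> nat \<Rightarrow> bool" where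
  "directional_sum E r T m \<longleftrightarrow> r \<in> ncarrier E \<and> (\<forall>i<m. bounded_operator E (T i)) \<and>
     (\<forall>z. (\<forall>i<m. norm (z i) \<le> 1) \<longrightarrow> nnorm E (operator_sum E r T z m) \<le> 1) \<and>
     (\<forall>z. (\<forall>i<m. norm (z i) = 1) \<longrightarrow> nnorm E (operator_sum E r T z m) = 1) \<and>
     (\<forall>y z \<epsilon>. (\<forall>i<m. 2 - \<epsilon> \<le> norm (y i - z i)) \<longrightarrow>
        2 - \<epsilon> \<le> ndist E (operator_sum E r T y m) (operator_sum E r T z m))"

text \<open>The two assumptions isolate what the transfer uses of \<open>Lp M p TYPE('a)\<close>;
  inside this locale no measure theory appears.\<close>

locale directional_nspace = normed_nspace E for E :: "'v nspace" +
  fixes X :: "'a::real_normed_vector itself"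
  assumes sphere_nonempty: "unit_sphere E \<noteq> {}"
    and approximable: "f \<in> unit_sphere E \<Longrightarrow> \<delta> > 0 \<Longrightarrow>
      \<exists>m r (T :: nat \<Rightarrow> 'a \<Rightarrow> 'v) w. directional_sum E r T m \<and> (\<forall>i<m. norm (w i) = 1) \<and>
        ndist E f (operator_sum E r T w m) < \<delta>"
begin

text \<open>Approximate \<open>f\<close> by a directional sum with directions \<open>w i\<close>,
  choose in X a far point \<open>z i\<close> for each \<open>w i\<close> that is almost as good for
  all pulled back functionals, and reassemble.\<close>

lemma diametral_transfer:
  assumes "finite F" "F \<subseteq> dual_space E"
    and X: "\<And>T. bounded_operator E T \<Longrightarrow> diametral (space_of X) ((\<lambda>\<phi> x. \<phi> (T x)) ` F)"
  shows "diametral E F"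
  unfolding diametral_def
proof (intro ballI allI impI)
  fix f and \<epsilon> :: real assume f: "f \<in> unit_sphere E" and \<epsilon>: "\<epsilon> > 0"
  \<comment> \<open>Finitely many functionals share one Lipschitz constant.\<close>
  from assms(1,2) have "\<exists>K\<ge>0. \<forall>\<phi>\<in>F. \<forall>x\<in>ncarrier E. \<forall>y\<in>ncarrier E. \<bar>\<phi> x - \<phi> y\<bar> \<le> K * ndist E x y"
  proof (induction rule: finite_induct)
    case empty
    then show ?case by auto
  next
    case (insert \<phi> F)
    then obtain K where K: "K \<ge> 0"
      "\<And>\<psi> x y. \<psi> \<in> F \<Longrightarrow> x \<in> ncarrier E \<Longrightarrow> y \<in> ncarrier E \<Longrightarrow> \<bar>\<psi> x - \<psi> y\<bar> \<le> K * ndist E x y"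
      by auto
    obtain L where L: "L \<ge> 0"
      "\<And>x y. x \<in> ncarrier E \<Longrightarrow> y \<in> ncarrier E \<Longrightarrow> \<bar>\<phi> x - \<phi> y\<bar> \<le> L * ndist E x y"
      using insert.prems by (auto elim: dual_ndist)
    have nn: "ndist E x y \<ge> 0" if "x \<in> ncarrier E" "y \<in> ncarrier E" for x y
      unfolding ndist_def using that by (intro norm_nonneg) auto
    have "\<bar>\<psi> x - \<psi> y\<bar> \<le> max K L * ndist E x y"
      if "\<psi> \<in> insert \<phi> F" "x \<in> ncarrier E" "y \<in> ncarrier E" for \<psi> x y
    proof -
      have "\<bar>\<psi> x - \<psi> y\<bar> \<le> K * ndist E x y \<or> \<bar>\<psi> x - \<psi> y\<bar> \<le> L * ndist E x y"
        using that K(2) L(2) by auto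
      then show ?thesis
        using nn[OF that(2,3)] mult_right_mono[of K "max K L" "ndist E x y"]
          mult_right_mono[of L "max K L" "ndist E x y"] by auto
    qed
    with K(1) show ?case
      by (intro exI[of _ "max K L"]) auto
  qed
  then obtain K where K: "K \<ge> 0"
    "\<And>\<phi> x y. \<phi> \<in> F \<Longrightarrow> x \<in> ncarrier E \<Longrightarrow> y \<in> ncarrier E \<Longrightarrow> \<bar>\<phi> x - \<phi> y\<bar> \<le> K * ndist E x y"
    by auto
  \<comment> \<open>Replacing \<open>f\<close> by the directional sum costs less than
    \<open>\<delta>\<close> in distance and at most \<open>K * \<delta>\<close> in each functional;
    both stay within \<open>\<epsilon> / 2\<close>.\<close>
  define \<delta> where "\<delta> = \<epsilon> / (2 * (K + 1))"
  have "\<delta> > 0"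
    using \<epsilon> K by (simp add: \<delta>_def)
  have \<delta>: "\<delta> * (K + 1) = \<epsilon> / 2"
    using K(1) by (simp add: \<delta>_def field_simps)
  obtain m r and T :: "nat \<Rightarrow> 'a \<Rightarrow> 'v" and w where ds: "directional_sum E r T m"
    and w: "\<And>i. i < m \<Longrightarrow> norm (w i) = 1" and fw: "ndist E f (operator_sum E r T w m) < \<delta>"
    using approximable[OF f \<open>\<delta> > 0\<close>] by blast
  have r: "r \<in> ncarrier E" and T: "\<And>i. i < m \<Longrightarrow> bounded_operator E (T i)"
    using ds by (auto simp: directional_sum_def)
  have closed: "operator_sum E r T z m \<in> ncarrier E" for z
    by (rule operator_sum_closed[OF r]) (rule T)
  have fE: "f \<in> ncarrier E"
    using f by (simp add: unit_sphere_def)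
  \<comment> \<open>The losses in a functional over the \<open>m\<close> summands total less than
    \<open>\<epsilon> / 2\<close>.\<close>
  define \<epsilon>' where "\<epsilon>' = \<epsilon> / (2 * (real m + 1))"
  have \<epsilon>': "\<epsilon>' > 0" "real m * \<epsilon>' < \<epsilon> / 2" "\<epsilon>' \<le> \<epsilon> / 2"
    using \<epsilon> by (simp_all add: \<epsilon>'_def field_simps)
  have "\<exists>y. norm y \<le> 1 \<and> 2 - \<epsilon>' \<le> norm (w i - y) \<and> (\<forall>\<phi>\<in>F. \<phi> (T i (w i)) - \<epsilon>' < \<phi> (T i y))"
    if i: "i < m" for i
  proof -
    have "w i \<in> unit_sphere (space_of X)"
      using w[OF i] by (simp add: unit_sphere_def)
    with X[OF T[OF i]] \<epsilon>'(1) obtain y where "y \<in> cball 0 1" "2 - \<epsilon>' \<le> norm (w i - y)"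
      "\<forall>\<psi>\<in>(\<lambda>\<phi> x. \<phi> (T i x)) ` F. \<psi> (w i) - \<epsilon>' < \<psi> y"
      unfolding diametral_def unit_ball_space_of ndist_space_of by blast
    then show ?thesis
      by (intro exI[of _ y]) simp
  qed
  then obtain z where z: "\<And>i. i < m \<Longrightarrow> norm (z i) \<le> 1" "\<And>i. i < m \<Longrightarrow> 2 - \<epsilon>' \<le> norm (w i - z i)"
    "\<And>i \<phi>. i < m \<Longrightarrow> \<phi> \<in> F \<Longrightarrow> \<phi> (T i (w i)) - \<epsilon>' < \<phi> (T i (z i))"
    by metis
  define g h where "g = operator_sum E r T z m" and "h = operator_sum E r T w m"
  have gh: "g \<in> ncarrier E" "h \<in> ncarrier E"
    using closed by (auto simp: g_def h_def)
  have "g \<in> unit_ball E"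
    using ds z(1) gh(1) by (auto simp: directional_sum_def unit_ball_def g_def)
  moreover have "2 - \<epsilon> \<le> ndist E f g"
  proof -
    have "2 - \<epsilon>' \<le> ndist E h g"
      using ds z(2) by (auto simp: directional_sum_def g_def h_def)
    moreover have "ndist E h g \<le> ndist E f h + ndist E f g"
      using ndist_triangle[of h f g] fE gh ndist_commute[of h f] by simp
    moreover have "\<delta> \<le> \<delta> * (K + 1)"
      using \<open>\<delta> > 0\<close> K(1) by simp
    ultimately show ?thesis
      using fw \<epsilon>' \<delta> by (simp add: h_def)
  qed
  moreover have "\<phi> f - \<epsilon> < \<phi> g" if "\<phi> \<in> F" for \<phi>
  proof -
    have \<phi>: "\<phi> \<in> dual_space E"
      using that assms(2) by blast
    have sum: "\<phi> (operator_sum E r T z m) = \<phi> r + (\<Sum>i<m. \<phi> (T i (z i)))" for z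
      by (rule dual_operator_sum[OF \<phi> r T])
    have "\<phi> h - real m * \<epsilon>' = \<phi> r + (\<Sum>i<m. \<phi> (T i (w i)) - \<epsilon>')"
      by (simp add: h_def sum sum_subtractf)
    also have "\<dots> \<le> \<phi> r + (\<Sum>i<m. \<phi> (T i (z i)))"
      using z(3)[OF _ that] by (intro add_left_mono sum_mono less_imp_le) auto
    also have "\<dots> = \<phi> g"
      by (simp add: g_def sum)
    finally have 1: "\<phi> h - real m * \<epsilon>' \<le> \<phi> g" .
    have "\<bar>\<phi> f - \<phi> h\<bar> \<le> K * ndist E f h"
      using K(2) that fE gh by blast
    also have "\<dots> \<le> K * \<delta>"
      using fw K(1) by (intro mult_left_mono) (auto simp: h_def)
    also have "\<dots> \<le> \<epsilon> / 2"
      using \<delta> \<open>\<delta> > 0\<close> by (simp add: algebra_simps)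
    finally show ?thesis
      using 1 \<epsilon>' by linarith
  qed
  ultimately show "\<exists>y\<in>unit_ball E. 2 - \<epsilon> \<le> ndist E f y \<and> (\<forall>\<phi>\<in>F. \<phi> f - \<epsilon> < \<phi> y)"
    by blast
qed

lemma DD2P_transfer:
  assumes "DD2P (space_of X)"
  shows "DD2P E"
  unfolding DD2P_iff_diametral
proof (intro allI impI diametral_transfer)
  fix F and T :: "'a \<Rightarrow> 'v" assume F: "finite F" "F \<subseteq> dual_space E" and T: "bounded_operator E T"
  have "(\<lambda>\<phi> x. \<phi> (T x)) ` F \<subseteq> dual_space (space_of X)"
    using F(2) bounded_linear_dual_comp[OF T] by (auto simp: dual_space_space_of)
  with assms F(1) show "diametral (space_of X) ((\<lambda>\<phi> x. \<phi> (T x)) ` F)"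
    by (simp add: space_of.DD2P_iff_diametral)
qed

lemma DLD2P_transfer:
  assumes "DLD2P (space_of X)"
  shows "DLD2P E"
  unfolding DLD2P_iff_diametral
proof (intro ballI diametral_transfer)
  fix \<phi> and T :: "'a \<Rightarrow> 'v" assume \<phi>: "\<phi> \<in> dual_space E" and T: "bounded_operator E T"
  have "(\<lambda>x. \<phi> (T x)) \<in> dual_space (space_of X)"
    using bounded_linear_dual_comp[OF T \<phi>] by (simp add: dual_space_space_of)
  with assms show "diametral (space_of X) ((\<lambda>\<phi> x. \<phi> (T x)) ` {\<phi>})"
    by (simp add: space_of.DLD2P_iff_diametral)
qed auto

text \<open>Replacing every \<open>z i\<close> by a far point gives a far point of the sum. Each
  \<open>z i\<close> lies in the closed convex hull of its far points, and
  \<open>operator_sum_closed_convex\<close> extends this to the whole sum.\<close>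

lemma Delta_points_operator_sum:
  assumes ds: "directional_sum E r T m"
    and z: "\<And>i. i < m \<Longrightarrow> z i \<in> Delta_points (space_of X)"
  shows "operator_sum E r T z m \<in> Delta_points E"
proof -
  have r: "r \<in> ncarrier E" and T: "\<And>i. i < m \<Longrightarrow> bounded_operator E (T i)"
    using ds by (auto simp: directional_sum_def)
  have closed: "operator_sum E r T z m \<in> ncarrier E" for z
    by (rule operator_sum_closed[OF r]) (rule T)
  have "operator_sum E r T z m \<in> closed_conv E (far_points E \<epsilon> (operator_sum E r T z m))"
    (is "_ \<in> closed_conv E ?S") if "\<epsilon> > 0" for \<epsilon>
  proof (rule operator_sum_closed_convex)
    have S: "?S \<subseteq> ncarrier E"
      by (auto simp: far_points_def unit_ball_def)
    show "convex_subset E (closed_conv E ?S)" "norm_closure E (closed_conv E ?S) \<subseteq> closed_conv E ?S"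
      by (rule closed_conv_facts[OF S])+
    show "z i \<in> closure (convex hull (far_points (space_of X) \<epsilon> (z i)))" if "i < m" for i
      using z[OF that] \<open>\<epsilon> > 0\<close> by (simp add: Delta_points_def closed_conv_space_of)
    fix y assume y: "\<And>i. i < m \<Longrightarrow> y i \<in> far_points (space_of X) \<epsilon> (z i)"
    have "operator_sum E r T y m \<in> ?S"
      using ds y closed
      by (auto simp: far_points_def unit_ball_def directional_sum_def ndist_space_of)
    then show "operator_sum E r T y m \<in> closed_conv E ?S"
      using closed_conv_facts(3)[OF S] by blast
  qed (use r T in auto)
  moreover have "nnorm E (operator_sum E r T z m) = 1"
    using ds z by (auto simp: directional_sum_def Delta_points_def unit_sphere_space_of)
  ultimately show ?thesis
    using closed by (simp add: Delta_points_def unit_sphere_def)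
qed

text \<open>The unit sphere is treated first, through directional sums over
  \<open>\<Delta>\<close>-points of X. The rest of the ball consists of convex combinations of
  antipodal points of the sphere.\<close>

lemma convex_DLD2P_transfer:
  assumes X: "convex_DLD2P (space_of X)"
  shows "convex_DLD2P E"
proof -
  define K where "K = closed_conv E (Delta_points E)"
  have D: "Delta_points E \<subseteq> ncarrier E" "Delta_points E \<subseteq> unit_ball E"
    by (auto simp: Delta_points_def unit_sphere_def unit_ball_def)
  note K = closed_conv_facts[OF D(1), folded K_def]
  have "K \<subseteq> unit_ball E"
    unfolding K_def
    by (rule closed_conv_minimal[OF D(2) convex_subset_unit_ball norm_closure_unit_ball])
  have sphere: "f \<in> K" if f: "f \<in> unit_sphere E" for f
  proof -
    have fE: "f \<in> ncarrier E"
      using f by (simp add: unit_sphere_def)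
    have "\<exists>g\<in>K. ndist E f g < \<delta>" if "\<delta> > 0" for \<delta>
    proof -
      obtain m r and T :: "nat \<Rightarrow> 'a \<Rightarrow> 'v" and w where ds: "directional_sum E r T m"
        and w: "\<And>i. i < m \<Longrightarrow> norm (w i) = 1" and fw: "ndist E f (operator_sum E r T w m) < \<delta>"
        using approximable[OF f \<open>\<delta> > 0\<close>] by blast
      have "operator_sum E r T w m \<in> K"
      proof (rule operator_sum_closed_convex[OF K(1,2)])
        show "w i \<in> closure (convex hull (Delta_points (space_of X)))" if "i < m" for i
          using X w[OF that] unfolding convex_DLD2P_def closed_conv_space_of unit_ball_space_of
          by (metis dist_0_norm mem_cball order_refl)
        fix z assume "\<And>i. i < m \<Longrightarrow> z i \<in> Delta_points (space_of X)"
        then have "operator_sum E r T z m \<in> Delta_points E"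
          by (intro Delta_points_operator_sum ds)
        then show "operator_sum E r T z m \<in> K"
          using K(3) by blast
      qed (use ds in \<open>auto simp: directional_sum_def\<close>)
      with fw show ?thesis
        by blast
    qed
    with fE have "f \<in> norm_closure E K"
      by (simp add: norm_closure_def)
    with K(2) show ?thesis
      by blast
  qed
  have conv: "nadd E (nscale E u a) (nscale E v b) \<in> K"
    if "a \<in> K" "b \<in> K" "0 \<le> u" "0 \<le> v" "u + v = 1" for a b u v
    using K(1) that by (simp add: convex_subset_def)
  have "unit_ball E \<subseteq> K"
  proof
    fix f assume f: "f \<in> unit_ball E"
    then have fE [simp]: "f \<in> ncarrier E" and f1: "nnorm E f \<le> 1"
      by (auto simp: unit_ball_def)
    define t where "t = nnorm E f"
    have t: "0 \<le> t" "t \<le> 1"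
      using norm_nonneg[OF fE] f1 by (simp_all add: t_def)
    \<comment> \<open>The axioms of the locale do not turn distance zero into equality, so
      \<open>f = t g\<close> is expressed by a distance. If \<open>t = 0\<close>, any point of the
      sphere will do.\<close>
    obtain g where g: "g \<in> unit_sphere E" "ndist E f (nscale E t g) = 0"
    proof (cases "t = 0")
      case True
      obtain g where "g \<in> unit_sphere E"
        using sphere_nonempty by blast
      with True show ?thesis
        by (intro that[of g]) (simp_all add: unit_sphere_def ndist_def add_scale_zero t_def)
    next
      case False
      with t show ?thesis
        by (intro that[of "nscale E (1 / t) f"])
          (simp_all add: unit_sphere_def norm_scale ndist_self, simp add: t_def)
    qed
    then have gE: "g \<in> ncarrier E"
      by (simp add: unit_sphere_def)
    have "nscale E (-1) g \<in> unit_sphere E"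
      using g(1) by (simp add: unit_sphere_def norm_scale)
    \<comment> \<open>The weights of \<open>g\<close> and its antipode are chosen with difference
      \<open>t\<close>.\<close>
    then have "nadd E (nscale E ((1 + t) / 2) g) (nscale E ((1 - t) / 2) (nscale E (-1) g)) \<in> K"
      using t g(1) by (intro conv sphere) (auto simp: field_simps)
    moreover have "nadd E (nscale E ((1 + t) / 2) g) (nscale E ((1 - t) / 2) (nscale E (-1) g)) =
        nscale E ((1 + t) / 2 + (1 - t) / 2 * (-1)) g"
      using gE by (simp only: scale_scale scale_add_left)
    moreover have "(1 + t) / 2 + (1 - t) / 2 * (-1) = t"
      by (simp add: field_simps)
    ultimately have "nscale E t g \<in> K"
      by simp
    then have "f \<in> norm_closure E K"
      using g(2) by (force simp: norm_closure_def)
    with K(2) show "f \<in> K"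
      by blast
  qed
  with \<open>K \<subseteq> unit_ball E\<close> show ?thesis
    by (auto simp: convex_DLD2P_def K_def)
qed

end


section \<open>The \<open>L\<^sub>p\<close>-norm of real functions\<close>

text \<open>For positive \<open>s\<close> and \<open>t\<close> this is convexity of the power
  function; if one of them is zero, it reduces to \<open>w powr q \<le> w\<close> for
  \<open>0 \<le> w \<le> 1\<close>.\<close>

lemma convex_powr_nonneg:
  fixes s t u v q :: real
  assumes "1 \<le> q" "0 \<le> s" "0 \<le> t" "0 \<le> u" "0 \<le> v" "u + v = 1"
  shows "(u * s + v * t) powr q \<le> u * s powr q + v * t powr q"
proof -
  have zero: "(w * r) powr q \<le> w * r powr q" if "0 \<le> w" "w \<le> 1" "0 \<le> r" for w r :: real
  proof -
    have "w powr q \<le> w powr 1"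
      using that assms(1) by (cases "w = 0") (use powr_mono'[of 1 q w] in auto)
    then have "w powr q * r powr q \<le> w * r powr q"
      using that by (intro mult_right_mono) auto
    then show ?thesis
      using that by (simp add: powr_mult)
  qed
  consider "s = 0" | "t = 0" | "s > 0" "t > 0"
    using assms by fastforce
  then show ?thesis
  proof cases
    case 1
    then show ?thesis using zero[of v t] assms by simp
  next
    case 2
    then show ?thesis using zero[of u s] assms by simp
  next
    case 3
    then show ?thesis
      using convex_onD[OF powr_convex[OF assms(1)], of v s t] assms(4-6) by (simp add: eq_diff_eq[symmetric])
  qed
qed

text \<open>
  Both cases of \<open>p\<close> are handled through a norm bound that is free of the junk values of
  \<^const>\<open>Lp_norm\<close> outside \<open>L\<^sub>p(\<mu>)\<close>.
\<close>

definition Lp_ball :: "'w measure \<Rightarrow> ennreal \<Rightarrow> real \<Rightarrow> ('w \<Rightarrow> real) \<Rightarrow> bool" where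
  "Lp_ball M p c g \<longleftrightarrow>
     (if p = \<infinity> then AE x in completion M. \<bar>g x\<bar> \<le> c
      else (\<integral>\<^sup>+x. ennreal (\<bar>g x\<bar> powr enn2real p) \<partial>completion M) \<le> ennreal (c powr enn2real p))"

locale Lp_exponent = finite_measure M for M :: "'w measure" +
  fixes p :: ennreal
  assumes p_ge_1: "1 \<le> p"
begin

abbreviation "N \<equiv> completion M"
abbreviation "q \<equiv> enn2real p"

lemma q_ge_1:
  assumes "p \<noteq> \<infinity>"
  shows "1 \<le> q"
proof -
  have "p < top"
    using assms by (simp add: top.not_eq_extremum)
  then have "enn2real 1 \<le> q"
    by (rule enn2real_mono[OF p_ge_1])
  then show ?thesis
    by simp
qed

lemma Lp_ball_iff:
  assumes [measurable]: "g \<in> borel_measurable N" and c: "0 \<le> c"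
  shows "Lp_ball M p c g \<longleftrightarrow> Lp_member M p g \<and> Lp_norm M p g \<le> c"
proof (cases "p = \<infinity>")
  case True
  let ?e = "esssup N (\<lambda>x. ereal \<bar>g x\<bar>)"
  show ?thesis
  proof
    assume "Lp_ball M p c g"
    with True have "AE x in N. ereal \<bar>g x\<bar> \<le> ereal c"
      by (simp add: Lp_ball_def)
    then have "?e \<le> ereal c"
      by (intro esssup_I) measurable
    then show "Lp_member M p g \<and> Lp_norm M p g \<le> c"
      \<comment> \<open>The essential supremum may be \<open>-\<infinity>\<close>, as on a null
        space; its real value is then 0, which \<open>0 \<le> c\<close> covers.\<close>
      using True c by (cases ?e) (auto simp: Lp_member_def Lp_norm_def)
  next
    assume *: "Lp_member M p g \<and> Lp_norm M p g \<le> c"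
    have "AE x in N. ereal \<bar>g x\<bar> \<le> ?e"
      by (rule esssup_AE)
    then have "AE x in N. \<bar>g x\<bar> \<le> c"
    proof eventually_elim
      case (elim x)
      then show ?case
        using * True by (cases ?e) (auto simp: Lp_member_def Lp_norm_def)
    qed
    with True show "Lp_ball M p c g"
      by (simp add: Lp_ball_def)
  qed
next
  case False
  then have q: "q \<ge> 1"
    by (rule q_ge_1)
  let ?I = "\<integral>x. \<bar>g x\<bar> powr q \<partial>N"
  have I: "(\<integral>\<^sup>+x. ennreal (\<bar>g x\<bar> powr q) \<partial>N) = ennreal ?I" if "integrable N (\<lambda>x. \<bar>g x\<bar> powr q)"
    using that by (intro nn_integral_eq_integral) auto
  have I0: "0 \<le> ?I"
    by (intro integral_nonneg_AE) auto
  have iff: "?I powr (1 / q) \<le> c \<longleftrightarrow> ?I \<le> c powr q"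
  proof
    assume "?I powr (1 / q) \<le> c"
    then have "(?I powr (1 / q)) powr q \<le> c powr q"
      using q by (intro powr_mono2) auto
    then show "?I \<le> c powr q"
      using q I0 by (simp add: powr_powr)
  next
    assume "?I \<le> c powr q"
    then have "?I powr (1 / q) \<le> (c powr q) powr (1 / q)"
      using q I0 by (intro powr_mono2) auto
    then show "?I powr (1 / q) \<le> c"
      using q c by (simp add: powr_powr)
  qed
  show ?thesis
  proof
    assume *: "Lp_ball M p c g"
    then have "(\<integral>\<^sup>+x. ennreal (\<bar>g x\<bar> powr q) \<partial>N) < \<infinity>"
      using False by (auto simp: Lp_ball_def intro: le_less_trans)
    then have int: "integrable N (\<lambda>x. \<bar>g x\<bar> powr q)"
      by (intro integrableI_nonneg) auto
    with * I show "Lp_member M p g \<and> Lp_norm M p g \<le> c"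
      using False iff by (simp add: Lp_ball_def Lp_member_def Lp_norm_def)
  next
    assume "Lp_member M p g \<and> Lp_norm M p g \<le> c"
    then show "Lp_ball M p c g"
      using False iff I by (simp add: Lp_ball_def Lp_member_def Lp_norm_def)
  qed
qed

text \<open>Holds for arbitrary \<open>g\<close>. For infinite \<open>p\<close>, a negative
  essential supremum forces the whole space to be null, where its value is infinite and is read as
  the real number 0.\<close>

lemma Lp_norm_nonneg: "0 \<le> Lp_norm M p g"
proof (cases "p = \<infinity>")
  case True
  let ?e = "esssup N (\<lambda>x. ereal \<bar>g x\<bar>)"
  have "0 \<le> ?e" if "?e \<noteq> -\<infinity>"
  proof (rule ccontr)
    assume neg: "\<not> 0 \<le> ?e"
    have "AE x in N. ereal \<bar>g x\<bar> \<le> ?e"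
      by (rule esssup_AE)
    then have "AE x in N. False"
    proof eventually_elim
      case (elim x)
      moreover have "0 \<le> ereal \<bar>g x\<bar>" by simp
      ultimately have "0 \<le> ?e" by (rule order_trans[rotated])
      with neg show ?case by simp
    qed
    then have "ae_filter N = bot"
      by (simp add: trivial_limit_def)
    \<comment> \<open>Over the trivial filter, the value is \<open>-\<infinity>\<close> for
      measurable functions and \<open>top\<close> by default for the others.\<close>
    then have "?e = top \<or> ?e = -\<infinity>"
      by (simp add: esssup_def Limsup_bot bot_ereal_def)
    with neg that show False
      by (auto simp: top_ereal_def)
  qed
  then show ?thesis
    using True by (cases "?e = -\<infinity>") (auto simp: Lp_norm_def intro: real_of_ereal_pos)
qed (simp add: Lp_norm_def)

lemma Lp_member_ball:
  assumes "Lp_member M p g"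
  shows "Lp_ball M p (Lp_norm M p g) g"
proof (rule Lp_ball_iff[THEN iffD2])
  show "g \<in> borel_measurable N"
    using assms by (simp add: Lp_member_def)
qed (use assms Lp_norm_nonneg in auto)

lemma Lp_ball_mono:
  assumes "AE x in N. \<bar>f x\<bar> \<le> \<bar>g x\<bar>" "Lp_ball M p c g"
  shows "Lp_ball M p c f"
proof (cases "p = \<infinity>")
  case True
  then have "AE x in N. \<bar>g x\<bar> \<le> c"
    using assms(2) by (simp add: Lp_ball_def)
  with assms(1) have "AE x in N. \<bar>f x\<bar> \<le> c"
    by eventually_elim simp
  with True show ?thesis
    by (simp add: Lp_ball_def)
next
  case False
  have "(\<integral>\<^sup>+x. ennreal (\<bar>f x\<bar> powr q) \<partial>N) \<le> (\<integral>\<^sup>+x. ennreal (\<bar>g x\<bar> powr q) \<partial>N)"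
  proof (rule nn_integral_mono_AE)
    show "AE x in N. ennreal (\<bar>f x\<bar> powr q) \<le> ennreal (\<bar>g x\<bar> powr q)"
      using assms(1) by eventually_elim (auto intro!: ennreal_leI powr_mono2)
  qed
  with False assms(2) show ?thesis
    by (auto simp: Lp_ball_def intro: order_trans)
qed

lemma Lp_ball_cmult:
  assumes [measurable]: "f \<in> borel_measurable N" and "Lp_ball M p c f" "0 \<le> c"
  shows "Lp_ball M p (\<bar>k\<bar> * c) (\<lambda>x. k * f x)"
proof (cases "p = \<infinity>")
  case True
  then have "AE x in N. \<bar>f x\<bar> \<le> c"
    using assms(2) by (simp add: Lp_ball_def)
  then have "AE x in N. \<bar>k * f x\<bar> \<le> \<bar>k\<bar> * c"
    by eventually_elim (simp add: abs_mult mult_left_mono)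
  with True show ?thesis
    by (simp add: Lp_ball_def)
next
  case False
  have "(\<integral>\<^sup>+x. ennreal (\<bar>k * f x\<bar> powr q) \<partial>N) = (\<integral>\<^sup>+x. ennreal (\<bar>k\<bar> powr q) * ennreal (\<bar>f x\<bar> powr q) \<partial>N)"
    by (simp add: abs_mult powr_mult ennreal_mult)
  also have "\<dots> = ennreal (\<bar>k\<bar> powr q) * (\<integral>\<^sup>+x. ennreal (\<bar>f x\<bar> powr q) \<partial>N)"
    by (rule nn_integral_cmult) measurable
  also have "\<dots> \<le> ennreal (\<bar>k\<bar> powr q) * ennreal (c powr q)"
    using False assms(2) by (intro mult_left_mono) (auto simp: Lp_ball_def)
  also have "\<dots> = ennreal ((\<bar>k\<bar> * c) powr q)"
    using assms(3) by (simp add: powr_mult ennreal_mult)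
  finally show ?thesis
    using False by (simp add: Lp_ball_def)
qed

text \<open>Minkowski's inequality by convexity: for finite \<open>p\<close>, with
  \<open>u = a / (a + b)\<close> and \<open>v = b / (a + b)\<close>, the power function is applied
  to the convex combination of \<open>\<bar>f\<bar> / a\<close> and
  \<open>\<bar>g\<bar> / b\<close>. The radii are positive so that these quotients make
  sense.\<close>

lemma Lp_ball_add:
  assumes [measurable]: "f \<in> borel_measurable N" "g \<in> borel_measurable N"
    and f: "Lp_ball M p a f" and g: "Lp_ball M p b g" and ab: "0 < a" "0 < b"
  shows "Lp_ball M p (a + b) (\<lambda>x. f x + g x)"
proof (cases "p = \<infinity>")
  case True
  then have "AE x in N. \<bar>f x\<bar> \<le> a" "AE x in N. \<bar>g x\<bar> \<le> b"
    using f g by (simp_all add: Lp_ball_def)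
  then have "AE x in N. \<bar>f x + g x\<bar> \<le> a + b"
    by eventually_elim linarith
  with True show ?thesis
    by (simp add: Lp_ball_def)
next
  case False
  then have q: "1 \<le> q"
    by (rule q_ge_1)
  define u v where "u = a / (a + b)" and "v = b / (a + b)"
  have uv: "0 < u" "0 < v" "u + v = 1"
    using ab by (auto simp: u_def v_def add_divide_distrib[symmetric])
  define K where "K = (a + b) powr q"
  have K: "K > 0"
    using ab by (simp add: K_def)
  \<comment> \<open>Clearing denominators in the convexity estimate gives these coefficients; they
    satisfy \<open>C * a powr q + D * b powr q = K\<close>.\<close>
  define C D where "C = K * u / a powr q" and "D = K * v / b powr q"
  have pw: "\<bar>s + t\<bar> powr q \<le> C * \<bar>s\<bar> powr q + D * \<bar>t\<bar> powr q" for s t :: real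
  proof -
    have "u * (\<bar>s\<bar> / a) + v * (\<bar>t\<bar> / b) = (\<bar>s\<bar> + \<bar>t\<bar>) / (a + b)"
      using ab by (simp add: u_def v_def add_divide_distrib)
    then have "((\<bar>s\<bar> + \<bar>t\<bar>) / (a + b)) powr q \<le> u * (\<bar>s\<bar> / a) powr q + v * (\<bar>t\<bar> / b) powr q"
      using convex_powr_nonneg[OF q, of "\<bar>s\<bar> / a" "\<bar>t\<bar> / b" u v] ab uv by simp
    then have "K * ((\<bar>s\<bar> + \<bar>t\<bar>) / (a + b)) powr q \<le> K * (u * (\<bar>s\<bar> / a) powr q + v * (\<bar>t\<bar> / b) powr q)"
      using K by (intro mult_left_mono) auto
    moreover have "K * ((\<bar>s\<bar> + \<bar>t\<bar>) / (a + b)) powr q = (\<bar>s\<bar> + \<bar>t\<bar>) powr q"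
      using ab by (simp add: K_def powr_divide)
    moreover have "\<bar>s + t\<bar> powr q \<le> (\<bar>s\<bar> + \<bar>t\<bar>) powr q"
      using q by (intro powr_mono2) auto
    ultimately show ?thesis
      using ab by (simp add: C_def D_def powr_divide algebra_simps)
  qed
  have coeff: "0 \<le> C" "0 \<le> D"
    using K uv by (auto simp: C_def D_def)
  have "(\<integral>\<^sup>+x. ennreal (\<bar>f x + g x\<bar> powr q) \<partial>N) \<le>
      (\<integral>\<^sup>+x. ennreal (C) * ennreal (\<bar>f x\<bar> powr q) +
        ennreal (D) * ennreal (\<bar>g x\<bar> powr q) \<partial>N)"
    using pw coeff
    by (intro nn_integral_mono)
      (simp add: ennreal_mult[symmetric] ennreal_plus[symmetric] del: ennreal_plus)
  also have "\<dots> = ennreal (C) * (\<integral>\<^sup>+x. ennreal (\<bar>f x\<bar> powr q) \<partial>N) +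
      ennreal (D) * (\<integral>\<^sup>+x. ennreal (\<bar>g x\<bar> powr q) \<partial>N)"
    by (simp add: nn_integral_add nn_integral_cmult)
  also have "\<dots> \<le> ennreal (C) * ennreal (a powr q) +
      ennreal (D) * ennreal (b powr q)"
    using False f g by (intro add_mono mult_left_mono) (auto simp: Lp_ball_def)
  also have "\<dots> = ennreal (K * u + K * v)"
  proof -
    have "C * a powr q = K * u" "D * b powr q = K * v"
      using ab by (simp_all add: C_def D_def)
    then show ?thesis
      using coeff K uv by (simp add: ennreal_mult[symmetric] ennreal_plus[symmetric] del: ennreal_plus)
  qed
  also have "K * u + K * v = K"
    using uv by (simp add: distrib_left[symmetric])
  finally show ?thesis
    using False by (simp add: Lp_ball_def K_def)
qed

section \<open>Order, triangle inequality and homogeneity of \<open>Lp_norm\<close>\<close>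

lemma Lp_mono:
  assumes "Lp_member M p g" "f \<in> borel_measurable N" "AE x in N. \<bar>f x\<bar> \<le> \<bar>g x\<bar>"
  shows "Lp_member M p f" "Lp_norm M p f \<le> Lp_norm M p g"
proof -
  have "Lp_ball M p (Lp_norm M p g) f"
    by (rule Lp_ball_mono[OF assms(3) Lp_member_ball[OF assms(1)]])
  then have *: "Lp_member M p f \<and> Lp_norm M p f \<le> Lp_norm M p g"
    by (rule Lp_ball_iff[OF assms(2) Lp_norm_nonneg, THEN iffD1])
  show "Lp_member M p f"
    using * by (rule conjunct1)
  show "Lp_norm M p f \<le> Lp_norm M p g"
    using * by (rule conjunct2)
qed

lemma Lp_norm_cong:
  assumes "f \<in> borel_measurable N" "g \<in> borel_measurable N" "AE x in N. \<bar>f x\<bar> = \<bar>g x\<bar>"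
  shows "Lp_norm M p f = Lp_norm M p g"
proof -
  have "(\<integral>x. \<bar>f x\<bar> powr q \<partial>N) = (\<integral>x. \<bar>g x\<bar> powr q \<partial>N)"
    using assms by (intro integral_cong_AE) auto
  moreover have "esssup N (\<lambda>x. ereal \<bar>f x\<bar>) = esssup N (\<lambda>x. ereal \<bar>g x\<bar>)"
    using assms by (intro esssup_AE_cong) auto
  ultimately show ?thesis
    by (simp add: Lp_norm_def)
qed

lemma Lp_add:
  assumes f: "Lp_member M p f" and g: "Lp_member M p g"
  shows "Lp_member M p (\<lambda>x. f x + g x)"
    "Lp_norm M p (\<lambda>x. f x + g x) \<le> Lp_norm M p f + Lp_norm M p g"
proof -
  have [measurable]: "f \<in> borel_measurable N" "g \<in> borel_measurable N"
    using f g by (auto simp: Lp_member_def)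
  \<comment> \<open>The extra \<open>e / 2\<close> makes both radii positive even when a norm is
    zero; \<open>e\<close> tends to zero at the end.\<close>
  have *: "Lp_member M p (\<lambda>x. f x + g x) \<and>
      Lp_norm M p (\<lambda>x. f x + g x) \<le> (Lp_norm M p f + e / 2) + (Lp_norm M p g + e / 2)"
    if "e > 0" for e
  proof (subst Lp_ball_iff[symmetric])
    have "Lp_ball M p (Lp_norm M p f + e / 2) f" "Lp_ball M p (Lp_norm M p g + e / 2) g"
      using f g that Lp_norm_nonneg[of f] Lp_norm_nonneg[of g] by (simp_all add: Lp_ball_iff)
    then show "Lp_ball M p ((Lp_norm M p f + e / 2) + (Lp_norm M p g + e / 2)) (\<lambda>x. f x + g x)"
      using that Lp_norm_nonneg[of f] Lp_norm_nonneg[of g] by (intro Lp_ball_add) auto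
  qed (use that Lp_norm_nonneg[of f] Lp_norm_nonneg[of g] in auto)
  show "Lp_member M p (\<lambda>x. f x + g x)"
    using *[of 1] by simp
  show "Lp_norm M p (\<lambda>x. f x + g x) \<le> Lp_norm M p f + Lp_norm M p g"
  proof (rule field_le_epsilon)
    fix e :: real assume "e > 0"
    from *[OF this] show "Lp_norm M p (\<lambda>x. f x + g x) \<le> Lp_norm M p f + Lp_norm M p g + e"
      by (simp add: field_simps)
  qed
qed

text \<open>One inequality comes from \<open>Lp_ball_cmult\<close>; the other is the same inequality
  for the factor \<open>1 / k\<close> and the function \<open>k * f x\<close>.\<close>

lemma Lp_cmult:
  assumes f: "Lp_member M p f"
  shows "Lp_member M p (\<lambda>x. k * f x)" "Lp_norm M p (\<lambda>x. k * f x) = \<bar>k\<bar> * Lp_norm M p f"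
proof -
  have *: "Lp_member M p (\<lambda>x. k * f x) \<and> Lp_norm M p (\<lambda>x. k * f x) \<le> \<bar>k\<bar> * Lp_norm M p f"
    if "Lp_member M p f" for k f
  proof (subst Lp_ball_iff[symmetric])
    have [measurable]: "f \<in> borel_measurable N"
      using that by (simp add: Lp_member_def)
    show "(\<lambda>x. k * f x) \<in> borel_measurable N"
      by measurable
    show "Lp_ball M p (\<bar>k\<bar> * Lp_norm M p f) (\<lambda>x. k * f x)"
      by (intro Lp_ball_cmult Lp_member_ball that Lp_norm_nonneg) measurable
  qed (simp add: Lp_norm_nonneg)
  show mem: "Lp_member M p (\<lambda>x. k * f x)"
    using *[OF f] by simp
  show "Lp_norm M p (\<lambda>x. k * f x) = \<bar>k\<bar> * Lp_norm M p f"
  proof (cases "k = 0")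
    case True
    then show ?thesis
      using *[OF f, of 0] Lp_norm_nonneg[of "\<lambda>x. 0"] by simp
  next
    case False
    have "\<bar>k\<bar> * Lp_norm M p (\<lambda>x. (1 / k) * (k * f x)) \<le> \<bar>k\<bar> * (\<bar>1 / k\<bar> * Lp_norm M p (\<lambda>x. k * f x))"
      using *[OF mem, of "1 / k"] by (intro mult_left_mono) auto
    then have "\<bar>k\<bar> * Lp_norm M p f \<le> Lp_norm M p (\<lambda>x. k * f x)"
      using False by (simp add: abs_divide)
    with *[OF f, of k] show ?thesis
      by simp
  qed
qed

text \<open>For finite \<open>p\<close> this rests on the finiteness of the measure.\<close>

lemma Lp_member_bounded:
  assumes [measurable]: "f \<in> borel_measurable N" and "AE x in N. \<bar>f x\<bar> \<le> c"
  shows "Lp_member M p f"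
proof (cases "p = \<infinity>")
  case True
  have "AE x in N. \<bar>f x\<bar> \<le> \<bar>c\<bar>"
    using assms(2) by eventually_elim simp
  with True have "Lp_ball M p \<bar>c\<bar> f"
    by (simp add: Lp_ball_def)
  then show ?thesis
    by (simp add: Lp_ball_iff)
next
  case False
  have fin: "finite_measure N"
    by (rule finite_measureI) simp
  have "integrable N (\<lambda>x. \<bar>f x\<bar> powr q)"
  proof (rule finite_measure.integrable_const_bound[OF fin])
    show "AE x in N. norm (\<bar>f x\<bar> powr q) \<le> \<bar>c\<bar> powr q"
      using assms(2) by eventually_elim (auto intro!: powr_mono2)
  qed measurable
  with False show ?thesis
    by (simp add: Lp_member_def)
qed

lemma Lp_norm_eq_0:
  assumes "Lp_member M p f" "Lp_norm M p f = 0"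
  shows "AE x in N. f x = 0"
proof -
  have [measurable]: "f \<in> borel_measurable N"
    using assms by (simp add: Lp_member_def)
  have *: "Lp_ball M p 0 f"
    using Lp_member_ball[OF assms(1)] assms(2) by simp
  show ?thesis
  proof (cases "p = \<infinity>")
    case True
    with * have "AE x in N. \<bar>f x\<bar> \<le> 0"
      by (simp add: Lp_ball_def)
    then show ?thesis
      by eventually_elim simp
  next
    case False
    with * have "(\<integral>\<^sup>+x. ennreal (\<bar>f x\<bar> powr q) \<partial>N) = 0"
      by (simp add: Lp_ball_def)
    then have "AE x in N. ennreal (\<bar>f x\<bar> powr q) = 0"
      by (subst (asm) nn_integral_0_iff_AE) auto
    then show ?thesis
      by eventually_elim (simp add: ennreal_eq_0_iff)
  qed
qed

end


section \<open>Lebesgue-Bochner spaces as normed spaces\<close>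

lemma Bochner_measurable_simple: "simple_function M f \<Longrightarrow> Bochner_measurable M f"
  unfolding Bochner_measurable_def by (intro exI[of _ "\<lambda>_. f"]) simp

lemma Bochner_measurable_const: "Bochner_measurable M (\<lambda>_. c)"
  by (intro Bochner_measurable_simple simple_function_const)

lemma Bochner_measurable_diff:
  assumes "Bochner_measurable M f" "Bochner_measurable M g"
  shows "Bochner_measurable M (\<lambda>x. f x - g x)"
  using Bochner_measurable_add[OF assms(1) Bochner_measurable_scaleR[OF assms(2), of "-1"]] by simp

lemma simple_function_indicator_scaleR:
  assumes "A \<in> sets M" "simple_function M f"
  shows "simple_function M (\<lambda>x. indicator A x *\<^sub>R f x)"
  using simple_function_indicator[OF assms(1)] assms(2) by (rule simple_function_compose2)

lemma Bochner_measurable_indicator: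
  assumes "A \<in> sets M" "Bochner_measurable M f"
  shows "Bochner_measurable M (\<lambda>x. indicator A x *\<^sub>R f x)"
proof -
  obtain s where s: "\<And>i. simple_function M (s i)" "AE x in M. (\<lambda>i. s i x) \<longlonglongrightarrow> f x"
    using assms(2) unfolding Bochner_measurable_def by blast
  have "AE x in M. (\<lambda>i. indicator A x *\<^sub>R s i x) \<longlonglongrightarrow> indicator A x *\<^sub>R f x"
    using s(2) by eventually_elim (intro tendsto_intros)
  with simple_function_indicator_scaleR[OF assms(1) s(1)] show ?thesis
    unfolding Bochner_measurable_def by (intro exI[of _ "\<lambda>i x. indicator A x *\<^sub>R s i x"]) blast
qed

text \<open>
  Discarding a null set and truncating the approximating functions makes the convergence pointwise
  everywhere and dominated.
\<close>

lemma Bochner_measurable_dominated_limit: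
  fixes f :: "'w \<Rightarrow> 'a::real_normed_vector"
  assumes "Bochner_measurable M f"
  obtains g s where "AE x in M. f x = g x" "g \<in> borel_measurable M" "\<And>i. simple_function M (s i)"
    "\<And>x. x \<in> space M \<Longrightarrow> (\<lambda>i. s i x) \<longlonglongrightarrow> g x"
    "\<And>i x. x \<in> space M \<Longrightarrow> norm (s i x) \<le> 2 * norm (g x)"
proof -
  obtain s where s: "\<And>i. simple_function M (s i)" "AE x in M. (\<lambda>i. s i x) \<longlonglongrightarrow> f x"
    using assms unfolding Bochner_measurable_def by blast
  from s(2) obtain Z where Z: "\<And>x. x \<in> space M - Z \<Longrightarrow> (\<lambda>i. s i x) \<longlonglongrightarrow> f x" "Z \<in> null_sets M"
    by (rule AE_E3) blast
  \<comment> \<open>After removing \<open>Z\<close> the convergence holds at every point, so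
    \<open>g\<close> is measurable for \<open>M\<close> itself and not only for its
    completion.\<close>
  define g where "g x = indicator (space M - Z) x *\<^sub>R f x" for x
  define t where "t i x = indicator (space M - Z) x *\<^sub>R s i x" for i x
  have C: "space M - Z \<in> sets M"
    using Z(2) by auto
  have t: "simple_function M (t i)" for i
    unfolding t_def by (rule simple_function_indicator_scaleR[OF C s(1)])
  have tg: "(\<lambda>i. t i x) \<longlonglongrightarrow> g x" if "x \<in> space M" for x
  proof (cases "x \<in> Z")
    case False
    with that Z(1)[of x] show ?thesis
      by (simp add: t_def g_def)
  qed (simp add: t_def g_def)
  have g: "g \<in> borel_measurable M"
    by (rule borel_measurable_LIMSEQ_metric[OF _ tg]) (rule borel_measurable_simple_function[OF t])
  \<comment> \<open>Where \<open>g x\<close> is nonzero, every large \<open>i\<close> satisfies this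
    bound, so cutting off does not change the limit; where \<open>g x\<close> is zero, the cut-off
    sequence is identically zero.\<close>
  define T where "T i = {x \<in> space M. norm (t i x) \<le> 2 * norm (g x)}" for i
  have T: "T i \<in> sets M" for i
  proof -
    have [measurable]: "(\<lambda>x. norm (t i x)) \<in> borel_measurable M" "(\<lambda>x. norm (g x)) \<in> borel_measurable M"
      using g borel_measurable_simple_function[OF t] by (auto intro: borel_measurable_norm)
    show ?thesis
      unfolding T_def by measurable
  qed
  show thesis
  proof (rule that[of g "\<lambda>i x. indicator (T i) x *\<^sub>R t i x"])
    show "AE x in M. f x = g x"
      using AE_not_in[OF Z(2)] AE_space by eventually_elim (simp add: g_def)
    show "simple_function M (\<lambda>x. indicator (T i) x *\<^sub>R t i x)" for i
      by (rule simple_function_indicator_scaleR[OF T t])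
    show "norm (indicator (T i) x *\<^sub>R t i x) \<le> 2 * norm (g x)" if "x \<in> space M" for i x
      by (auto simp: indicator_def T_def)
    show "(\<lambda>i. indicator (T i) x *\<^sub>R t i x) \<longlonglongrightarrow> g x" if x: "x \<in> space M" for x
    proof (cases "g x = 0")
      case True
      then have zero: "indicator (T i) x *\<^sub>R t i x = 0" for i
        by (auto simp: T_def indicator_def)
      show ?thesis
        unfolding zero True by (rule tendsto_const)
    next
      case False
      have "(\<lambda>i. norm (t i x)) \<longlonglongrightarrow> norm (g x)"
        using tg[OF x] by (rule tendsto_norm)
      then have "eventually (\<lambda>i. norm (t i x) < 2 * norm (g x)) sequentially"
        using False by (intro order_tendstoD) auto
      then have "eventually (\<lambda>i. t i x = indicator (T i) x *\<^sub>R t i x) sequentially"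
        by eventually_elim (use x in \<open>auto simp: T_def indicator_def\<close>)
      with tg[OF x] show ?thesis
        by (rule Lim_transform_eventually)
    qed
  qed (rule g)
qed

lemma sum_indicator_disjoint:
  fixes c :: "nat \<Rightarrow> 'a::real_vector"
  assumes "disjoint_family_on A {..<m}" "k < m" "x \<in> A k"
  shows "(\<Sum>i<m. indicator (A i) x *\<^sub>R c i) = c k"
proof -
  have "indicator (A i) x *\<^sub>R c i = (if i = k then c i else 0)" if "i < m" for i
    using assms that by (auto simp: disjoint_family_on_def indicator_def)
  then have "(\<Sum>i<m. indicator (A i) x *\<^sub>R c i) = (\<Sum>i<m. if i = k then c i else 0)"
    by (intro sum.cong) auto
  with assms(2) show ?thesis
    by simp
qed

lemma sum_indicator_outside:
  fixes c :: "nat \<Rightarrow> 'a::real_vector"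
  assumes "\<And>i. i < m \<Longrightarrow> x \<notin> A i"
  shows "(\<Sum>i<m. indicator (A i) x *\<^sub>R c i) = 0"
  using assms by (intro sum.neutral) auto

section \<open>Vector space operations and norm of \<open>Lp M p T\<close>\<close>

context Lp_exponent
begin

lemma Lp_functions_iff:
  "f \<in> Lp_functions M p \<longleftrightarrow> Bochner_measurable M f \<and> Lp_member M p (\<lambda>x. norm (f x))"
  by (simp add: Lp_functions_def)

lemma Lp_functions_mono:
  assumes "Bochner_measurable M f" "g \<in> Lp_functions M p" "AE x in N. norm (f x) \<le> norm (g x)"
  shows "f \<in> Lp_functions M p" "Lp_norm M p (\<lambda>x. norm (f x)) \<le> Lp_norm M p (\<lambda>x. norm (g x))"
  using Lp_mono[of "\<lambda>x. norm (g x)" "\<lambda>x. norm (f x)"] assms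
  by (simp_all add: Lp_functions_iff Bochner_measurable_norm)

lemma Lp_functions_add:
  assumes f: "f \<in> Lp_functions M p" and g: "g \<in> Lp_functions M p"
  shows "(\<lambda>x. f x + g x) \<in> Lp_functions M p"
    "Lp_norm M p (\<lambda>x. norm (f x + g x)) \<le> Lp_norm M p (\<lambda>x. norm (f x)) + Lp_norm M p (\<lambda>x. norm (g x))"
proof -
  have fg: "Bochner_measurable M f" "Bochner_measurable M g"
    "Lp_member M p (\<lambda>x. norm (f x))" "Lp_member M p (\<lambda>x. norm (g x))"
    using f g by (simp_all add: Lp_functions_iff)
  have m: "Bochner_measurable M (\<lambda>x. f x + g x)"
    using fg by (intro Bochner_measurable_add)
  note a = Lp_add[OF fg(3,4)]
  have le: "AE x in N. \<bar>norm (f x + g x)\<bar> \<le> \<bar>norm (f x) + norm (g x)\<bar>"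
    by (simp add: norm_triangle_ineq)
  note b = Lp_mono[OF a(1) Bochner_measurable_norm[OF m] le]
  from m b(1) show "(\<lambda>x. f x + g x) \<in> Lp_functions M p"
    by (simp add: Lp_functions_iff)
  from b(2) a(2) show "Lp_norm M p (\<lambda>x. norm (f x + g x)) \<le> Lp_norm M p (\<lambda>x. norm (f x)) + Lp_norm M p (\<lambda>x. norm (g x))"
    by (rule order_trans)
qed

lemma Lp_functions_scaleR:
  assumes "f \<in> Lp_functions M p"
  shows "(\<lambda>x. c *\<^sub>R f x) \<in> Lp_functions M p"
    "Lp_norm M p (\<lambda>x. norm (c *\<^sub>R f x)) = \<bar>c\<bar> * Lp_norm M p (\<lambda>x. norm (f x))"
proof -
  have f: "Bochner_measurable M f" "Lp_member M p (\<lambda>x. norm (f x))"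
    using assms by (simp_all add: Lp_functions_iff)
  show "(\<lambda>x. c *\<^sub>R f x) \<in> Lp_functions M p"
    using Lp_cmult(1)[OF f(2), of "\<bar>c\<bar>"] Bochner_measurable_scaleR[OF f(1)] by (simp add: Lp_functions_iff)
  show "Lp_norm M p (\<lambda>x. norm (c *\<^sub>R f x)) = \<bar>c\<bar> * Lp_norm M p (\<lambda>x. norm (f x))"
    using Lp_cmult(2)[OF f(2), of "\<bar>c\<bar>"] by simp
qed

lemma Lp_functions_bounded:
  assumes "Bochner_measurable M f" "AE x in N. norm (f x) \<le> c"
  shows "f \<in> Lp_functions M p"
  using assms Lp_member_bounded[OF Bochner_measurable_norm[OF assms(1)], of c]
  by (simp add: Lp_functions_iff)

lemma Lp_functions_norm_cong:
  assumes "Bochner_measurable M f" "Bochner_measurable M g" "AE x in N. norm (f x) = norm (g x)"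
  shows "Lp_norm M p (\<lambda>x. norm (f x)) = Lp_norm M p (\<lambda>x. norm (g x))"
  by (rule Lp_norm_cong) (use assms in \<open>simp_all add: Bochner_measurable_norm\<close>)

lemma Lp_carrier_ae_class: "ae_class M f \<in> ncarrier (Lp M p T)" if "f \<in> Lp_functions M p"
  using that unfolding Lp_def ae_class_def nspace.select_convs by (rule quotientI)

lemma Lp_carrierE:
  assumes "F \<in> ncarrier (Lp M p T)"
  obtains f where "f \<in> Lp_functions M p" "F = ae_class M f"
  using assms unfolding Lp_def ae_class_def nspace.select_convs by (rule quotientE)

lemma Lp_functions_Bochner: "f \<in> Lp_functions M p \<Longrightarrow> Bochner_measurable M f"
  by (simp add: Lp_functions_iff)

text \<open>Once every element is written as \<open>ae_class M f\<close>, the operations act on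
  representatives and each axiom becomes a pointwise identity or a fact about
  \<open>Lp_norm\<close>.\<close>

lemma normed_nspace_Lp: "normed_nspace (Lp M p TYPE('a::real_normed_vector))" (is "normed_nspace ?E")
proof
  note B = Lp_functions_Bochner Bochner_measurable_add Bochner_measurable_scaleR
  fix x y z :: "('w \<Rightarrow> 'a) set" and c d :: real
  assume "x \<in> ncarrier ?E"
  then obtain f where f: "f \<in> Lp_functions M p" "x = ae_class M f"
    by (rule Lp_carrierE)
  show "nscale ?E c x \<in> ncarrier ?E"
    using f by (simp add: nscale_Lp B Lp_carrier_ae_class Lp_functions_scaleR)
  show "nscale ?E (c + d) x = nadd ?E (nscale ?E c x) (nscale ?E d x)"
    "nscale ?E c (nscale ?E d x) = nscale ?E (c * d) x" "nscale ?E 1 x = x"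
    using f by (simp_all add: nscale_Lp nadd_Lp B scaleR_add_left)
  show "nnorm ?E (nscale ?E c x) = \<bar>c\<bar> * nnorm ?E x"
    using f Lp_functions_scaleR(2)[OF f(1), of c] by (simp only: nscale_Lp nnorm_Lp B)
  assume "y \<in> ncarrier ?E"
  then obtain g where g: "g \<in> Lp_functions M p" "y = ae_class M g"
    by (rule Lp_carrierE)
  show "nadd ?E x y \<in> ncarrier ?E"
    using f g by (simp add: nadd_Lp B Lp_carrier_ae_class Lp_functions_add)
  show "nadd ?E x y = nadd ?E y x" "nadd ?E x (nscale ?E 0 y) = x"
    "nscale ?E c (nadd ?E x y) = nadd ?E (nscale ?E c x) (nscale ?E c y)"
    using f g nadd_Lp[OF Lp_functions_Bochner[OF f(1)] Bochner_measurable_const[of M 0]]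
    by (simp_all add: nscale_Lp nadd_Lp B add.commute scaleR_add_right)
  show "nnorm ?E (nadd ?E x y) \<le> nnorm ?E x + nnorm ?E y"
    using f g Lp_functions_add(2)[OF f(1) g(1)] by (simp only: nadd_Lp nnorm_Lp B)
  assume "z \<in> ncarrier ?E"
  then obtain h where h: "h \<in> Lp_functions M p" "z = ae_class M h"
    by (rule Lp_carrierE)
  show "nadd ?E (nadd ?E x y) z = nadd ?E x (nadd ?E y z)"
    using f g h by (simp add: nadd_Lp B add.assoc)
qed

lemma ndist_Lp:
  assumes "f \<in> Lp_functions M p" "g \<in> Lp_functions M p"
  shows "ndist (Lp M p T) (ae_class M f) (ae_class M g) = Lp_norm M p (\<lambda>x. norm (f x - g x))"
proof -
  note B = assms[THEN Lp_functions_Bochner]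
  show ?thesis
    using B Bochner_measurable_scaleR[OF B(2), of "-1"] Bochner_measurable_diff[OF B]
    by (simp add: ndist_def nscale_Lp nadd_Lp nnorm_Lp)
qed

end


section \<open>Approximation by functions with constant values on large sets\<close>

text \<open>Counterpart of \<open>operator_sum\<close> on the level of functions; in its uses
  \<open>r\<close> vanishes on the sets \<open>A i\<close>.\<close>

definition step_sum :: "('w \<Rightarrow> 'a) \<Rightarrow> (nat \<Rightarrow> 'w set) \<Rightarrow> (nat \<Rightarrow> 'a) \<Rightarrow> nat \<Rightarrow> 'w \<Rightarrow> 'a::real_vector" where
  "step_sum r A c m x = r x + (\<Sum>i<m. indicator (A i) x *\<^sub>R c i)"

lemma step_sum_0: "step_sum r A c 0 = r"
  by (simp add: step_sum_def fun_eq_iff)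

lemma step_sum_Suc: "step_sum r A c (Suc m) = (\<lambda>x. step_sum r A c m x + indicator (A m) x *\<^sub>R c m)"
  by (simp add: step_sum_def fun_eq_iff)

context Lp_exponent
begin

lemma indicator_Lp_functions:
  assumes "A \<in> sets M"
  shows "(\<lambda>x. indicator A x *\<^sub>R c) \<in> Lp_functions M p"
proof (rule Lp_functions_bounded)
  show "Bochner_measurable M (\<lambda>x. indicator A x *\<^sub>R c)"
    by (rule Bochner_measurable_indicator[OF assms Bochner_measurable_const])
  show "AE x in N. norm (indicator A x *\<^sub>R c) \<le> norm c"
    by (simp add: indicator_def)
qed

lemma Lp_norm_indicator_pos:
  assumes A: "A \<in> sets M" "A \<notin> null_sets M" and "v \<noteq> 0"
  shows "0 < Lp_norm M p (\<lambda>x. norm (indicator A x *\<^sub>R v))"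
proof (rule ccontr)
  let ?g = "\<lambda>x. indicator A x *\<^sub>R v"
  assume "\<not> 0 < Lp_norm M p (\<lambda>x. norm (?g x))"
  then have "Lp_norm M p (\<lambda>x. norm (?g x)) = 0"
    using Lp_norm_nonneg[of "\<lambda>x. norm (?g x)"] by linarith
  moreover have "?g \<in> Lp_functions M p"
    by (rule indicator_Lp_functions[OF A(1)])
  ultimately have "AE x in N. norm (?g x) = 0"
    by (intro Lp_norm_eq_0) (simp_all add: Lp_functions_iff)
  then have "AE x in N. x \<notin> A"
    by eventually_elim (use \<open>v \<noteq> 0\<close> in \<open>auto simp: indicator_def\<close>)
  then have "AE x in M. x \<notin> A"
    by (simp add: AE_completion_iff)
  then have "A \<in> null_sets M"
    using A(1) by (simp add: AE_iff_null_sets)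
  with A(2) show False
    by simp
qed

text \<open>The two norm hypotheses play different parts: \<open>norm_sum\<close> gives the clauses
  on ball and sphere, while \<open>norm_step\<close> gives the distance clause, since
  \<open>r\<close> cancels in differences and only the step part is left to carry the norm.\<close>

lemma directional_sum_Lp:
  fixes r :: "'w \<Rightarrow> 'a::real_normed_vector"
  assumes r: "r \<in> Lp_functions M p" and A: "\<And>i. i < m \<Longrightarrow> A i \<in> sets M"
    and disj: "disjoint_family_on A {..<m}"
    and r0: "\<And>i x. i < m \<Longrightarrow> x \<in> A i \<Longrightarrow> r x = 0"
    and norm_step: "Lp_norm M p (\<lambda>x. norm (step_sum (\<lambda>_. 0) A v m x)) = 1"
    and norm_sum: "Lp_norm M p (\<lambda>x. norm (step_sum r A v m x)) = 1"
  defines "T \<equiv> \<lambda>i x. ae_class M (\<lambda>\<omega>. indicator (A i) \<omega> *\<^sub>R (norm (v i) *\<^sub>R x))"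
  shows "directional_sum (Lp M p TYPE('a)) (ae_class M r) T m"
    and "\<And>z. operator_sum (Lp M p TYPE('a)) (ae_class M r) T z m =
      ae_class M (step_sum r A (\<lambda>i. norm (v i) *\<^sub>R z i) m)"
proof -
  let ?E = "Lp M p TYPE('a)"
  have mem: "step_sum r A c k \<in> Lp_functions M p" if "k \<le> m" "r \<in> Lp_functions M p" for c k and r :: "'w \<Rightarrow> 'a"
    using that(1)
  proof (induction k)
    case 0
    show ?case using that(2) by (simp add: step_sum_0)
  next
    case (Suc k)
    then show ?case
      unfolding step_sum_Suc by (intro Lp_functions_add(1) indicator_Lp_functions A) auto
  qed
  have zero: "(\<lambda>_. 0 :: 'a) \<in> Lp_functions M p"
    by (rule Lp_functions_bounded[of _ 0]) (auto intro: Bochner_measurable_const)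
  have op: "operator_sum ?E (ae_class M r) T z k = ae_class M (step_sum r A (\<lambda>i. norm (v i) *\<^sub>R z i) k)"
    if "k \<le> m" for z k
    using that
  proof (induction k)
    case 0
    show ?case by (simp add: step_sum_0)
  next
    case (Suc k)
    then have k: "k < m" "k \<le> m"
      by simp_all
    show ?case
      unfolding operator_sum.simps Suc.IH[OF k(2)] step_sum_Suc
      unfolding T_def
      by (rule nadd_Lp)
        (rule Lp_functions_Bochner[OF mem[OF k(2) r]]
          Lp_functions_Bochner[OF indicator_Lp_functions[OF A[OF k(1)]]])+
  qed
  then show op_m: "operator_sum ?E (ae_class M r) T z m =
      ae_class M (step_sum r A (\<lambda>i. norm (v i) *\<^sub>R z i) m)" for z
    by simp
  have on: "step_sum r' A c m x = c k" if "k < m" "x \<in> A k" "r' x = 0" for r' :: "'w \<Rightarrow> 'a" and c k x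
    using sum_indicator_disjoint[OF disj that(1,2), of c] that(3) by (simp add: step_sum_def)
  have off: "step_sum r' A c m x = r' x" if "\<And>i. i < m \<Longrightarrow> x \<notin> A i" for r' :: "'w \<Rightarrow> 'a" and c x
    using sum_indicator_outside[of m x A c] that by (simp add: step_sum_def)
  have cases: "(\<exists>k<m. x \<in> A k \<and> r x = 0) \<or> (\<forall>i<m. x \<notin> A i)" for x
    using r0 by blast
  note mem_m = mem[OF order_refl]
  note B = mem_m[THEN Lp_functions_Bochner]
  show "directional_sum ?E (ae_class M r) T m"
    unfolding directional_sum_def op_m
  proof (intro conjI allI impI)
    show "ae_class M r \<in> ncarrier ?E"
      by (rule Lp_carrier_ae_class[OF r])
    show "bounded_operator ?E (T i)" if i: "i < m" for i
      unfolding bounded_operator_def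
    proof (intro conjI allI)
      fix x y and c :: real
      note S = indicator_Lp_functions[OF A[OF i]]
      show "T i x \<in> ncarrier ?E"
        unfolding T_def by (rule Lp_carrier_ae_class[OF S])
      show "T i (x + y) = nadd ?E (T i x) (T i y)"
        unfolding T_def nadd_Lp[OF Lp_functions_Bochner[OF S] Lp_functions_Bochner[OF S]]
        by (simp add: scaleR_add_right)
      show "T i (c *\<^sub>R x) = nscale ?E c (T i x)"
        unfolding T_def nscale_Lp[OF Lp_functions_Bochner[OF S]] by (simp add: mult_ac)
      have "nnorm ?E (T i x) = norm x * (norm (v i) * Lp_norm M p (indicator (A i)))" for x
      proof -
        have ind: "Lp_member M p (indicator (A i) :: 'w \<Rightarrow> real)"
          by (rule Lp_member_bounded[of _ 1])
            (use A[OF i] in \<open>auto simp: indicator_def intro: measurable_completion borel_measurable_indicator\<close>)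
        have "nnorm ?E (T i x) = Lp_norm M p (\<lambda>\<omega>. norm (indicator (A i) \<omega> *\<^sub>R (norm (v i) *\<^sub>R x)))"
          unfolding T_def by (rule nnorm_Lp) (rule Lp_functions_Bochner[OF S])
        also have "\<dots> = Lp_norm M p (\<lambda>\<omega>. (norm (v i) * norm x) * indicator (A i) \<omega>)"
          by (simp add: mult_ac)
        also have "\<dots> = \<bar>norm (v i) * norm x\<bar> * Lp_norm M p (indicator (A i))"
          by (rule Lp_cmult(2)[OF ind])
        finally show ?thesis
          by (simp add: mult_ac)
      qed
      then show "\<exists>K. \<forall>x. nnorm ?E (T i x) \<le> K * norm x"
        by (intro exI[of _ "norm (v i) * Lp_norm M p (indicator (A i))"]) (simp add: mult_ac)
    qed
    show "nnorm ?E (ae_class M (step_sum r A (\<lambda>i. norm (v i) *\<^sub>R z i) m)) \<le> 1"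
      if z: "\<forall>i<m. norm (z i) \<le> 1" for z
    proof -
      \<comment> \<open>On \<open>A i\<close> this compares \<open>norm (v i) * norm (z i)\<close>
        with \<open>norm (v i)\<close>; elsewhere both sides are \<open>norm (r x)\<close>.\<close>
      have "norm (step_sum r A (\<lambda>i. norm (v i) *\<^sub>R z i) m x) \<le> norm (step_sum r A v m x)" for x
        using cases[of x] z by (auto simp: on off mult_left_le)
      then have "Lp_norm M p (\<lambda>x. norm (step_sum r A (\<lambda>i. norm (v i) *\<^sub>R z i) m x)) \<le> 1"
        unfolding norm_sum[symmetric] by (intro Lp_functions_mono(2)[OF B[OF r] mem_m[OF r]]) simp
      then show ?thesis
        unfolding nnorm_Lp[OF B[OF r]] .
    qed
    show "nnorm ?E (ae_class M (step_sum r A (\<lambda>i. norm (v i) *\<^sub>R z i) m)) = 1"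
      if z: "\<forall>i<m. norm (z i) = 1" for z
    proof -
      have "norm (step_sum r A (\<lambda>i. norm (v i) *\<^sub>R z i) m x) = norm (step_sum r A v m x)" for x
        using cases[of x] z by (auto simp: on off)
      then show ?thesis
        unfolding nnorm_Lp[OF B[OF r]] by (simp add: norm_sum)
    qed
    show "2 - \<epsilon> \<le> ndist ?E (ae_class M (step_sum r A (\<lambda>i. norm (v i) *\<^sub>R y i) m))
        (ae_class M (step_sum r A (\<lambda>i. norm (v i) *\<^sub>R z i) m))" (is "_ \<le> ndist ?E (ae_class M ?y) (ae_class M ?z)")
      if yz: "\<forall>i<m. 2 - \<epsilon> \<le> norm (y i - z i)" for y z \<epsilon>
    proof -
      \<comment> \<open>Truncation at zero makes \<open>t\<close> a nonnegative factor also when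
        \<open>\<epsilon>\<close> exceeds 2.\<close>
      define t where "t = max 0 (2 - \<epsilon>)"
      have le: "norm (t *\<^sub>R step_sum (\<lambda>_. 0) A v m x) \<le> norm (?y x - ?z x)" for x
      proof (cases "\<exists>k<m. x \<in> A k \<and> r x = 0")
        case True
        then obtain k where k: "k < m" "x \<in> A k" "r x = 0"
          by blast
        have "t \<le> norm (y k - z k)"
          using yz k(1) by (simp add: t_def)
        then have "t * norm (v k) \<le> norm (norm (v k) *\<^sub>R (y k - z k))"
          using mult_left_mono[of t "norm (y k - z k)" "norm (v k)"] by (simp add: mult.commute)
        moreover have "0 \<le> t"
          by (simp add: t_def)
        ultimately show ?thesis
          using k by (simp add: on scaleR_diff_right)
      next
        case False
        with cases[of x] have "\<forall>i<m. x \<notin> A i"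
          by blast
        then show ?thesis
          by (simp add: off)
      qed
      have d: "(\<lambda>x. ?y x + (-1) *\<^sub>R ?z x) \<in> Lp_functions M p"
        by (intro Lp_functions_add(1) Lp_functions_scaleR(1) mem_m r)
      then have d: "(\<lambda>x. ?y x - ?z x) \<in> Lp_functions M p"
        by simp
      have "t = Lp_norm M p (\<lambda>x. norm (t *\<^sub>R step_sum (\<lambda>_. 0) A v m x))"
        using Lp_functions_scaleR(2)[OF mem_m[OF zero], of t v] norm_step by (simp add: t_def)
      also have "\<dots> \<le> Lp_norm M p (\<lambda>x. norm (?y x - ?z x))"
        by (rule Lp_functions_mono(2)[OF Bochner_measurable_scaleR[OF B[OF zero]] d]) (use le in simp)
      finally show ?thesis
        unfolding ndist_Lp[OF mem_m[OF r] mem_m[OF r]] by (simp add: t_def)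
    qed
  qed
qed

end

section \<open>Step approximation of norm-one functions, for finite and infinite exponent\<close>

context Lp_exponent
begin

text \<open>Collects the hypotheses of \<open>directional_sum_Lp\<close>; the values
  \<open>v i\<close> are nonzero so that they have directions.\<close>

definition step_approximable :: "('w \<Rightarrow> 'a::real_normed_vector) \<Rightarrow> real \<Rightarrow> bool" where
  "step_approximable h \<delta> \<longleftrightarrow> (\<exists>m A v r. r \<in> Lp_functions M p \<and> (\<forall>i<m. A i \<in> sets M \<and> v i \<noteq> 0) \<and>
     disjoint_family_on A {..<m} \<and> (\<forall>i<m. \<forall>x\<in>A i. r x = 0) \<and>
     Lp_norm M p (\<lambda>x. norm (step_sum (\<lambda>_. 0) A v m x)) = 1 \<and>
     Lp_norm M p (\<lambda>x. norm (step_sum r A v m x)) = 1 \<and>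
     step_sum r A v m \<in> Lp_functions M p \<and>
     Lp_norm M p (\<lambda>x. norm (h x - step_sum r A v m x)) < \<delta>)"

lemma Lp_functions_diff:
  assumes f: "f \<in> Lp_functions M p" and g: "g \<in> Lp_functions M p"
  shows "(\<lambda>x. f x - g x) \<in> Lp_functions M p"
  using Lp_functions_add(1)[OF f Lp_functions_scaleR(1)[OF g, of "-1"]] by simp

lemma Lp_norm_diff_commute: "Lp_norm M p (\<lambda>x. norm (f x - g x)) = Lp_norm M p (\<lambda>x. norm (g x - f x))"
  by (simp add: norm_minus_commute)

lemma Lp_norm_diff_triangle:
  assumes "f \<in> Lp_functions M p" "g \<in> Lp_functions M p" "h \<in> Lp_functions M p"
  shows "Lp_norm M p (\<lambda>x. norm (f x - h x)) \<le>
    Lp_norm M p (\<lambda>x. norm (f x - g x)) + Lp_norm M p (\<lambda>x. norm (g x - h x))"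
  using Lp_functions_add(2)[OF Lp_functions_diff[OF assms(1,2)] Lp_functions_diff[OF assms(2,3)]] by simp

lemma Lp_norm_le_diff:
  assumes "f \<in> Lp_functions M p" "g \<in> Lp_functions M p"
  shows "Lp_norm M p (\<lambda>x. norm (f x)) \<le> Lp_norm M p (\<lambda>x. norm (g x)) + Lp_norm M p (\<lambda>x. norm (f x - g x))"
  using Lp_functions_add(2)[OF assms(2) Lp_functions_diff[OF assms]] by simp

lemma simple_function_Lp_functions:
  assumes "simple_function M s"
  shows "s \<in> Lp_functions M p"
proof (rule Lp_functions_bounded)
  have "finite (norm ` s ` space M)"
    using assms by (simp add: simple_function_def)
  then have "norm (s x) \<le> Max (norm ` s ` space M)" if "x \<in> space M" for x
    using that by (intro Max_ge) auto
  then show "AE x in N. norm (s x) \<le> Max (norm ` s ` space M)"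
    by (intro AE_I2) simp
qed (rule Bochner_measurable_simple[OF assms])

text \<open>Dominated convergence along the truncated approximants, applied to the
  \<open>q\<close>-th power of the error.\<close>

lemma simple_functions_dense:
  assumes p: "p \<noteq> \<infinity>" and h: "h \<in> Lp_functions M p" and \<delta>: "0 < \<delta>"
  obtains s where "simple_function M s" "Lp_norm M p (\<lambda>x. norm (h x - s x)) < \<delta>"
proof -
  have q: "1 \<le> q"
    by (rule q_ge_1[OF p])
  have hB: "Bochner_measurable M h"
    by (rule Lp_functions_Bochner[OF h])
  obtain g s where ae: "AE x in M. h x = g x" and g: "g \<in> borel_measurable M"
    and s: "\<And>i. simple_function M (s i)" "\<And>x. x \<in> space M \<Longrightarrow> (\<lambda>i. s i x) \<longlonglongrightarrow> g x"
      "\<And>i x. x \<in> space M \<Longrightarrow> norm (s i x) \<le> 2 * norm (g x)"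
    using Bochner_measurable_dominated_limit[OF hB] by blast
  have aeN: "AE x in N. h x = g x"
    by (rule AE_completion[OF ae])
  have [measurable]: "(\<lambda>x. norm (h x)) \<in> borel_measurable N"
    by (rule Bochner_measurable_norm[OF hB])
  have d[measurable]: "(\<lambda>x. norm (h x - s i x)) \<in> borel_measurable N" for i
    by (intro Bochner_measurable_norm Bochner_measurable_diff hB Bochner_measurable_simple s)
  have "(\<lambda>i. \<integral>x. \<bar>norm (h x - s i x)\<bar> powr q \<partial>N) \<longlonglongrightarrow> (\<integral>x. 0 \<partial>N)"
  \<comment> \<open>The factor 3 comes from \<open>norm (h x) + 2 * norm (g x)\<close>, where
    \<open>g\<close> agrees with \<open>h\<close> almost everywhere.\<close>
  proof (rule integral_dominated_convergence[where w = "\<lambda>x. 3 powr q * \<bar>norm (h x)\<bar> powr q"])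
    have "integrable N (\<lambda>x. \<bar>norm (h x)\<bar> powr q)"
      using h p by (simp add: Lp_functions_iff Lp_member_def)
    then show "integrable N (\<lambda>x. 3 powr q * \<bar>norm (h x)\<bar> powr q)"
      by (rule integrable_mult_right)
    show "AE x in N. (\<lambda>i. \<bar>norm (h x - s i x)\<bar> powr q) \<longlonglongrightarrow> 0"
      using aeN AE_space
    proof eventually_elim
      case (elim x)
      then have "(\<lambda>i. \<bar>norm (h x - s i x)\<bar>) \<longlonglongrightarrow> \<bar>norm (h x - g x)\<bar>"
        using s(2)[of x] by (intro tendsto_intros) simp
      with elim(1) have "(\<lambda>i. \<bar>norm (h x - s i x)\<bar>) \<longlonglongrightarrow> 0"
        by simp
      then show ?case
        using q by (intro tendsto_zero_powrI[where b = q] tendsto_const always_eventually) auto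
    qed
    show "AE x in N. norm (\<bar>norm (h x - s i x)\<bar> powr q) \<le> 3 powr q * \<bar>norm (h x)\<bar> powr q" for i
      using aeN AE_space
    proof eventually_elim
      case (elim x)
      have "norm (h x - s i x) \<le> norm (h x) + norm (s i x)"
        by (rule norm_triangle_ineq4)
      with s(3)[of x i] elim have "norm (h x - s i x) \<le> 3 * norm (h x)"
        by simp
      then have "norm (h x - s i x) powr q \<le> (3 * norm (h x)) powr q"
        using q by (intro powr_mono2) auto
      then show ?case
        by (simp add: powr_mult)
    qed
  qed measurable
  then have "eventually (\<lambda>i. (\<integral>x. \<bar>norm (h x - s i x)\<bar> powr q \<partial>N) < \<delta> powr q) sequentially"
    using \<delta> by (intro order_tendstoD) auto
  then obtain i where "(\<integral>x. \<bar>norm (h x - s i x)\<bar> powr q \<partial>N) < \<delta> powr q"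
    by (auto simp: eventually_sequentially)
  then have "(\<integral>x. \<bar>norm (h x - s i x)\<bar> powr q \<partial>N) powr (1 / q) < (\<delta> powr q) powr (1 / q)"
    using q by (intro powr_less_mono2) auto
  also have "\<dots> = \<delta>"
    using q \<delta> by (simp add: powr_powr)
  finally have "Lp_norm M p (\<lambda>x. norm (h x - s i x)) < \<delta>"
    using p by (simp add: Lp_norm_def)
  with s(1) that show thesis
    by blast
qed

text \<open>A simple function close to \<open>h\<close> is rescaled to norm one and split into its
  nonzero level sets; the remainder \<open>r\<close> is zero.\<close>

lemma step_approximable_finite:
  assumes p: "p \<noteq> \<infinity>" and h: "h \<in> Lp_functions M p" "Lp_norm M p (\<lambda>x. norm (h x)) = 1" and \<delta>: "0 < \<delta>"
  shows "step_approximable h \<delta>"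
proof -
  \<comment> \<open>One \<open>\<eta>\<close> is spent on the approximation and one on the
    rescaling; \<open>\<eta> < 1\<close> keeps the norm of \<open>s'\<close> positive.\<close>
  define \<eta> where "\<eta> = min (\<delta> / 2) (1 / 2)"
  have \<eta>: "0 < \<eta>" "\<eta> < 1" "2 * \<eta> \<le> \<delta>"
    using \<delta> by (auto simp: \<eta>_def)
  obtain s' where s': "simple_function M s'" "Lp_norm M p (\<lambda>x. norm (h x - s' x)) < \<eta>"
    using simple_functions_dense[OF p h(1) \<eta>(1)] by blast
  note s'L = simple_function_Lp_functions[OF s'(1)]
  define c where "c = Lp_norm M p (\<lambda>x. norm (s' x))"
  have c: "\<bar>c - 1\<bar> < \<eta>"
    using Lp_norm_le_diff[OF h(1) s'L] Lp_norm_le_diff[OF s'L h(1)] s'(2) h(2)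
    by (simp add: c_def Lp_norm_diff_commute[of s' h])
  then have c0: "c > 0"
    using \<eta>(2) by linarith
  define s where "s x = (1 / c) *\<^sub>R s' x" for x
  have s: "simple_function M s"
    unfolding s_def[abs_def] by (rule simple_function_compose1[OF s'(1)])
  note sL = simple_function_Lp_functions[OF s]
  have norm_s: "Lp_norm M p (\<lambda>x. norm (s x)) = 1"
    using Lp_functions_scaleR(2)[OF s'L, of "1 / c"] c0 by (simp add: s_def c_def)
  have "(\<lambda>x. norm (s' x - s x)) = (\<lambda>x. norm ((c - 1) *\<^sub>R s x))"
    using c0 by (auto simp: s_def fun_eq_iff scaleR_diff_left diff_divide_distrib)
  then have "Lp_norm M p (\<lambda>x. norm (s' x - s x)) = \<bar>c - 1\<bar>"
    using Lp_functions_scaleR(2)[OF sL, of "c - 1"] norm_s by simp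
  with c have hs: "Lp_norm M p (\<lambda>x. norm (h x - s x)) < \<delta>"
    using Lp_norm_diff_triangle[OF h(1) s'L sL] s'(2) \<eta>(3) by linarith
  define D where "D = s ` space M - {0}"
  have "finite D"
    using s by (simp add: D_def simple_function_def)
  then obtain v where v: "bij_betw v {0..<card D} D"
    using ex_bij_betw_nat_finite by blast
  define m where "m = card D"
  define A where "A i = s -` {v i} \<inter> space M" for i
  have v_D: "v i \<in> D" if "i < m" for i
    using v that unfolding m_def bij_betw_def by auto
  have A: "A i \<in> sets M" if "i < m" for i
    unfolding A_def by (rule simple_functionD(2)[OF s])
  have v_inj: "v i \<noteq> v j" if "i < m" "j < m" "i \<noteq> j" for i j
    using v that unfolding m_def bij_betw_def inj_on_def by auto
  have disj: "disjoint_family_on A {..<m}"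
    unfolding disjoint_family_on_def
  proof (intro ballI impI)
    fix i j assume "i \<in> {..<m}" "j \<in> {..<m}" "i \<noteq> j"
    then have "v i \<noteq> v j"
      using v_inj by simp
    then show "A i \<inter> A j = {}"
      by (auto simp: A_def)
  qed
  \<comment> \<open>The equality is confined to \<open>space M\<close>: the sets \<open>A i\<close>
    lie inside it, while \<open>s\<close> is arbitrary outside.\<close>
  have step: "step_sum (\<lambda>_. 0) A v m x = s x" if x: "x \<in> space M" for x
  proof (cases "s x = 0")
    case True
    then have "x \<notin> A i" if "i < m" for i
      using v_D[OF that] by (auto simp: A_def D_def)
    with True show ?thesis
      using sum_indicator_outside[of m x A v] by (simp add: step_sum_def)
  next
    case False
    with x have "s x \<in> D"
      by (simp add: D_def)
    then obtain k where k: "k < m" "s x = v k"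
      using v unfolding m_def bij_betw_def by (metis atLeastLessThan_iff image_iff)
    with x have "x \<in> A k"
      by (simp add: A_def)
    with k show ?thesis
      using sum_indicator_disjoint[OF disj, of k x v] by (simp add: step_sum_def)
  qed
  have "simple_function M (step_sum (\<lambda>_. 0) A v m)"
    using s step by (subst simple_function_cong) auto
  then have mem: "step_sum (\<lambda>_. 0) A v m \<in> Lp_functions M p"
    by (rule simple_function_Lp_functions)
  have 1: "Lp_norm M p (\<lambda>x. norm (step_sum (\<lambda>_. 0) A v m x)) = 1"
    unfolding norm_s[symmetric]
    by (rule Lp_functions_norm_cong)
      (use mem sL step in \<open>auto intro: Lp_functions_Bochner AE_I2\<close>)
  have "Lp_norm M p (\<lambda>x. norm (h x - step_sum (\<lambda>_. 0) A v m x)) = Lp_norm M p (\<lambda>x. norm (h x - s x))"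
    by (rule Lp_functions_norm_cong)
      (use mem sL step h(1) in \<open>auto intro: Lp_functions_Bochner Lp_functions_diff AE_I2\<close>)
  with hs have 2: "Lp_norm M p (\<lambda>x. norm (h x - step_sum (\<lambda>_. 0) A v m x)) < \<delta>"
    by simp
  have zero: "(\<lambda>_. 0) \<in> Lp_functions M p"
    by (rule simple_function_Lp_functions) simp
  show ?thesis
    unfolding step_approximable_def
    by (rule exI[of _ m], rule exI[of _ A], rule exI[of _ v], rule exI[of _ "\<lambda>_. 0"])
      (use A v_D disj mem 1 2 zero in \<open>auto simp: D_def\<close>)
qed

text \<open>
  The approximating functions have countably many values \<open>v\<close>, and the sets of points of \<open>B\<close> at which
  \<open>g\<close> is close to \<open>v\<close> cover \<open>B\<close>, so one of them is not null.
\<close>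

lemma Bochner_measurable_almost_constant:
  fixes g :: "'w \<Rightarrow> 'a::real_normed_vector"
  assumes g: "g \<in> borel_measurable M" and s: "\<And>i. simple_function M (s i)"
    and lim: "\<And>x. x \<in> space M \<Longrightarrow> (\<lambda>i. s i x) \<longlonglongrightarrow> g x"
    and B: "B \<in> sets M" "B \<notin> null_sets M" and \<eta>: "0 < \<eta>"
  obtains A v where "A \<in> sets M" "A \<notin> null_sets M" "A \<subseteq> B" "\<And>x. x \<in> A \<Longrightarrow> norm (g x - v) < \<eta>"
proof -
  define A where "A v = B \<inter> {x \<in> space M. norm (g x - v) < \<eta>}" for v
  have A: "A v \<in> sets M" for v
  proof -
    have "(\<lambda>x. norm (g x - v)) \<in> borel_measurable M"
      by (rule borel_measurable_continuous_onI[THEN measurable_compose[OF g]]) (intro continuous_intros)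
    then have "{x \<in> space M. norm (g x - v) < \<eta>} \<in> sets M"
      by measurable
    with B(1) show ?thesis
      unfolding A_def by (rule sets.Int)
  qed
  define V where "V = (\<Union>i. s i ` space M)"
  have "countable V"
    unfolding V_def by (rule countable_UN) (use s in \<open>auto simp: simple_function_def intro: countable_finite\<close>)
  have "B \<subseteq> (\<Union>v\<in>V. A v)"
  proof
    fix x assume x: "x \<in> B"
    then have xM: "x \<in> space M"
      using B(1) sets.sets_into_space by blast
    have "(\<lambda>i. norm (g x - s i x)) \<longlonglongrightarrow> norm (g x - g x)"
      by (intro tendsto_intros lim xM)
    then have "eventually (\<lambda>i. norm (g x - s i x) < \<eta>) sequentially"
      using \<eta> by (intro order_tendstoD) auto
    then obtain i where "norm (g x - s i x) < \<eta>"
      by (auto simp: eventually_sequentially)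
    with x xM show "x \<in> (\<Union>v\<in>V. A v)"
      by (auto simp: A_def V_def)
  qed
  have "\<exists>v. A v \<notin> null_sets M"
  proof (rule ccontr)
    assume "\<nexists>v. A v \<notin> null_sets M"
    then have "(\<Union>v\<in>V. A v) \<in> null_sets M"
      using \<open>countable V\<close> by (intro null_sets_UN') auto
    then have "B \<in> null_sets M"
      using B(1) \<open>B \<subseteq> (\<Union>v\<in>V. A v)\<close> by (rule null_sets_subset)
    with B(2) show False
      by simp
  qed
  then obtain v where "A v \<notin> null_sets M"
    by blast
  with A show thesis
    by (intro that[of "A v" v]) (auto simp: A_def)
qed

lemma Lp_norm_infinity_le_iff:
  assumes p: "p = \<infinity>" and f: "Bochner_measurable M f" and "0 \<le> c"
  shows "f \<in> Lp_functions M p \<and> Lp_norm M p (\<lambda>x. norm (f x)) \<le> c \<longleftrightarrow> (AE x in M. norm (f x) \<le> c)"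
proof -
  have "Lp_ball M p c (\<lambda>x. norm (f x)) \<longleftrightarrow> (AE x in M. norm (f x) \<le> c)"
    unfolding Lp_ball_def by (simp add: p AE_completion_iff)
  with Lp_ball_iff[OF Bochner_measurable_norm[OF f] \<open>0 \<le> c\<close>] f show ?thesis
    unfolding Lp_functions_iff by iprover
qed

text \<open>One set \<open>A\<close> of positive measure suffices: there \<open>h\<close> is
  replaced by a unit vector \<open>v\<close>, and this alone already forces the essential supremum
  up to one.\<close>

lemma step_approximable_infinity:
  fixes h :: "'w \<Rightarrow> 'a::real_normed_vector"
  assumes p: "p = \<infinity>" and h: "h \<in> Lp_functions M p" "Lp_norm M p (\<lambda>x. norm (h x)) = 1" and \<delta>: "0 < \<delta>"
  shows "step_approximable h \<delta>"
proof -
  \<comment> \<open>On \<open>A\<close> the error is at most \<open>3 * \<eta>\<close>, which is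
    below \<open>\<delta>\<close>; the bound by \<open>1 / 4\<close> keeps the centre
    \<open>u\<close> away from zero.\<close>
  define \<eta> where "\<eta> = min (\<delta> / 4) (1 / 4)"
  have \<eta>: "0 < \<eta>" "4 * \<eta> \<le> 1" "4 * \<eta> \<le> \<delta>"
    by (use \<delta> in \<open>auto simp: \<eta>_def\<close>)
  note AE_le = Lp_norm_infinity_le_iff[OF p, THEN iffD1]
    and norm_le = Lp_norm_infinity_le_iff[OF p, THEN iffD2, THEN conjunct2]
  have hB: "Bochner_measurable M h"
    by (rule Lp_functions_Bochner[OF h(1)])
  obtain g s where ae: "AE x in M. h x = g x" and g: "g \<in> borel_measurable M"
    and s: "\<And>i. simple_function M (s i)" "\<And>x. x \<in> space M \<Longrightarrow> (\<lambda>i. s i x) \<longlonglongrightarrow> g x"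
      "\<And>i x. x \<in> space M \<Longrightarrow> norm (s i x) \<le> 2 * norm (g x)"
    using Bochner_measurable_dominated_limit[OF hB] by blast
  have [measurable]: "(\<lambda>x. norm (g x)) \<in> borel_measurable M"
    by (rule measurable_compose[OF g borel_measurable_norm])
  have h1: "AE x in M. norm (h x) \<le> 1"
    by (rule AE_le[OF hB]) (simp_all add: h)
  define B where "B = {x \<in> space M. 1 - \<eta> < norm (g x) \<and> norm (g x) \<le> 1}"
  have B: "B \<in> sets M"
    unfolding B_def by measurable
  \<comment> \<open>Since \<open>norm (h x)\<close> is at most one almost everywhere, a null
    \<open>B\<close> would bring the norm of \<open>h\<close> down to
    \<open>1 - \<eta>\<close>.\<close>
  have nB: "B \<notin> null_sets M"
  proof
    assume "B \<in> null_sets M"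
    then have "AE x in M. x \<notin> B"
      by (rule AE_not_in)
    with ae h1 AE_space have "AE x in M. norm (h x) \<le> 1 - \<eta>"
      by eventually_elim (auto simp: B_def)
    then have "Lp_norm M p (\<lambda>x. norm (h x)) \<le> 1 - \<eta>"
      using \<eta> by (intro norm_le hB) simp_all
    with h(2) \<eta>(1) show False
      by simp
  qed
  obtain A u where A: "A \<in> sets M" "A \<notin> null_sets M" "A \<subseteq> B"
    and u: "\<And>x. x \<in> A \<Longrightarrow> norm (g x - u) < \<eta>"
    using Bochner_measurable_almost_constant[OF g s(1,2) B nB \<eta>(1)] by blast
  have "A \<noteq> {}"
    using A(2) by auto
  then obtain x0 where x0: "x0 \<in> A"
    by blast
  have "\<bar>norm u - 1\<bar> < 2 * \<eta>"
  proof -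
    have "\<bar>norm (g x0) - norm u\<bar> < \<eta>"
      using u[OF x0] norm_triangle_ineq3[of "g x0" u] by linarith
    moreover have "1 - \<eta> < norm (g x0)" "norm (g x0) \<le> 1"
      using x0 A(3) by (auto simp: B_def)
    ultimately show ?thesis
      using \<eta>(1) by linarith
  qed
  then have u0: "norm u > 0"
    using \<eta> by linarith
  define v where "v = (1 / norm u) *\<^sub>R u"
  have v: "norm v = 1"
    using u0 by (simp add: v_def)
  have uv: "norm (u - v) < 2 * \<eta>"
  proof -
    have "u - v = (norm u - 1) *\<^sub>R v"
      using u0 by (simp add: v_def scaleR_diff_left diff_divide_distrib)
    with v \<open>\<bar>norm u - 1\<bar> < 2 * \<eta>\<close> show ?thesis
      by simp
  qed
  have gv: "norm (g x - v) \<le> 3 * \<eta>" if "x \<in> A" for x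
    using u[OF that] uv norm_triangle_ineq[of "g x - u" "u - v"] by simp
  \<comment> \<open>Off \<open>A\<close> the function is kept unchanged, so no approximation is
    required there.\<close>
  define r where "r x = indicator (space M - A) x *\<^sub>R h x" for x
  have rB: "Bochner_measurable M r"
    unfolding r_def using A(1) by (intro Bochner_measurable_indicator hB) auto
  have r: "r \<in> Lp_functions M p"
    by (rule Lp_functions_mono(1)[OF rB h(1)]) (simp add: r_def indicator_def)
  let ?A = "\<lambda>_::nat. A" and ?v = "\<lambda>_::nat. v"
  have step: "step_sum r' ?A ?v (Suc 0) x = (if x \<in> A then r' x + v else r' x)" for r' x
    by (simp add: step_sum_def)
  have indA: "(\<lambda>x. indicator A x *\<^sub>R v) \<in> Lp_functions M p"
    by (rule indicator_Lp_functions[OF A(1)])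
  have stepL: "step_sum r' ?A ?v (Suc 0) \<in> Lp_functions M p" if "r' \<in> Lp_functions M p" for r'
    unfolding step_sum_Suc step_sum_0 by (rule Lp_functions_add(1)[OF that indA])
  have zero: "(\<lambda>_. 0 :: 'a) \<in> Lp_functions M p"
    by (rule simple_function_Lp_functions) simp
  note stepB = stepL[THEN Lp_functions_Bochner]
  \<comment> \<open>On \<open>A\<close>, which is not null, the function has the value
    \<open>v\<close> of norm one.\<close>
  have lower: "1 \<le> Lp_norm M p (\<lambda>x. norm (step_sum r' ?A ?v (Suc 0) x))"
    if r': "r' \<in> Lp_functions M p" "\<And>x. x \<in> A \<Longrightarrow> r' x = 0" for r'
  proof (rule ccontr)
    let ?n = "Lp_norm M p (\<lambda>x. norm (step_sum r' ?A ?v (Suc 0) x))"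
    assume *: "\<not> 1 \<le> ?n"
    have "AE x in M. norm (step_sum r' ?A ?v (Suc 0) x) \<le> ?n"
      by (rule AE_le[OF stepB[OF r'(1)] Lp_norm_nonneg]) (simp add: stepL[OF r'(1)])
    then have "AE x in M. x \<notin> A"
    proof eventually_elim
      case (elim x)
      with * v r'(2)[of x] show ?case
        by (auto simp: step)
    qed
    then have "A \<in> null_sets M"
      using A(1) by (simp add: AE_iff_null_sets)
    with A(2) show False
      by simp
  qed
  have upper: "Lp_norm M p (\<lambda>x. norm (step_sum r' ?A ?v (Suc 0) x)) \<le> 1"
    if r': "r' \<in> Lp_functions M p" "AE x in M. norm (r' x) \<le> 1" "\<And>x. x \<in> A \<Longrightarrow> r' x = 0" for r'
  proof -
    have "AE x in M. norm (step_sum r' ?A ?v (Suc 0) x) \<le> 1"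
      using r'(2) by eventually_elim (use r'(3) v in \<open>auto simp: step\<close>)
    then show ?thesis
      by (rule norm_le[OF stepB[OF r'(1)] zero_le_one])
  qed
  have r1: "AE x in M. norm (r x) \<le> 1"
    using h1 by eventually_elim (simp add: r_def indicator_def)
  have r0: "r x = 0" if "x \<in> A" for x
    using that by (simp add: r_def)
  have "AE x in M. norm (h x - step_sum r ?A ?v (Suc 0) x) \<le> 3 * \<eta>"
    using ae AE_space by eventually_elim (use gv \<eta>(1) in \<open>auto simp: step r_def\<close>)
  then have "Lp_norm M p (\<lambda>x. norm (h x - step_sum r ?A ?v (Suc 0) x)) \<le> 3 * \<eta>"
    using \<eta>(1) by (intro norm_le Bochner_measurable_diff hB stepB r) simp_all
  then have dist: "Lp_norm M p (\<lambda>x. norm (h x - step_sum r ?A ?v (Suc 0) x)) < \<delta>"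
    using \<eta> by linarith
  have v0: "v \<noteq> 0"
    using v by auto
  have disj: "disjoint_family_on ?A {..<Suc 0}"
    by (simp add: disjoint_family_on_def)
  have n0: "Lp_norm M p (\<lambda>x. norm (step_sum (\<lambda>_. 0) ?A ?v (Suc 0) x)) = 1"
    by (intro antisym upper lower zero) auto
  have n1: "Lp_norm M p (\<lambda>x. norm (step_sum r ?A ?v (Suc 0) x)) = 1"
    by (intro antisym upper lower r r1 r0)
  show ?thesis
    unfolding step_approximable_def
    by (rule exI[of _ "Suc 0"], rule exI[of _ ?A], rule exI[of _ ?v], rule exI[of _ r])
      (use r A(1) v0 disj r0 n0 n1 stepL[OF r] dist in simp)
qed

section \<open>\<open>Lp M p TYPE('a)\<close> as a directional space, and the transfer of the three
  properties\<close>

lemma directional_nspace_Lp: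
  assumes "space M \<notin> null_sets M" and "\<exists>x::'a::real_normed_vector. x \<noteq> 0"
  shows "directional_nspace TYPE('a) (Lp M p TYPE('a))"
proof -
  let ?E = "Lp M p TYPE('a)"
  interpret normed_nspace ?E
    by (rule normed_nspace_Lp)
  show ?thesis
  proof
    obtain x :: 'a where "x \<noteq> 0"
      using assms(2) by blast
    define f where "f \<omega> = indicator (space M) \<omega> *\<^sub>R x" for \<omega>
    have f: "f \<in> Lp_functions M p"
      unfolding f_def by (rule indicator_Lp_functions) simp
    define c where "c = Lp_norm M p (\<lambda>x. norm (f x))"
    have c: "c > 0"
      unfolding c_def f_def using assms(1) \<open>x \<noteq> 0\<close> by (intro Lp_norm_indicator_pos) auto
    have "nscale ?E (1 / c) (ae_class M f) \<in> unit_sphere ?E"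
      using c f by (simp add: unit_sphere_def norm_scale Lp_carrier_ae_class nnorm_Lp Lp_functions_Bochner c_def)
    then show "unit_sphere ?E \<noteq> {}"
      by blast
  next
    fix F and \<delta> :: real assume F: "F \<in> unit_sphere ?E" and \<delta>: "0 < \<delta>"
    then have "F \<in> ncarrier ?E" "nnorm ?E F = 1"
      by (simp_all add: unit_sphere_def)
    then obtain h where h: "h \<in> Lp_functions M p" "F = ae_class M h"
      by (auto elim: Lp_carrierE)
    have h1: "Lp_norm M p (\<lambda>x. norm (h x)) = 1"
      using \<open>nnorm ?E F = 1\<close> h by (simp add: nnorm_Lp Lp_functions_Bochner)
    have "step_approximable h \<delta>"
      using step_approximable_finite[OF _ h(1) h1 \<delta>] step_approximable_infinity[OF _ h(1) h1 \<delta>] by blast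
    then obtain m A v r where r: "r \<in> Lp_functions M p" and Av: "\<forall>i<m. A i \<in> sets M \<and> v i \<noteq> 0"
      and disj: "disjoint_family_on A {..<m}" and r0': "\<forall>i<m. \<forall>x\<in>A i. r x = 0"
      and n0: "Lp_norm M p (\<lambda>x. norm (step_sum (\<lambda>_. 0) A v m x)) = 1"
      and n1: "Lp_norm M p (\<lambda>x. norm (step_sum r A v m x)) = 1"
      and L: "step_sum r A v m \<in> Lp_functions M p"
      and dist: "Lp_norm M p (\<lambda>x. norm (h x - step_sum r A v m x)) < \<delta>"
      unfolding step_approximable_def by (elim exE conjE)
    have A: "A i \<in> sets M" and v: "v i \<noteq> 0" if "i < m" for i
      using Av that by simp_all
    have r0: "r x = 0" if "i < m" "x \<in> A i" for i x
      using r0' that by simp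
    \<comment> \<open>The operator belonging to \<open>A i\<close> contains the factor
      \<open>norm (v i)\<close>, so the unit vectors \<open>w i\<close> reproduce the values
      \<open>v i\<close>.\<close>
    define w where "w i = v i /\<^sub>R norm (v i)" for i
    have "step_sum r A (\<lambda>i. norm (v i) *\<^sub>R w i) m = step_sum r A v m"
      unfolding step_sum_def[abs_def] using v by (intro ext arg_cong2[where f = "(+)"] sum.cong) (auto simp: w_def)
    then show "\<exists>m r (T :: nat \<Rightarrow> 'a \<Rightarrow> ('w \<Rightarrow> 'a) set) w. directional_sum ?E r T m \<and> (\<forall>i<m. norm (w i) = 1) \<and>
        ndist ?E F (operator_sum ?E r T w m) < \<delta>"
      using directional_sum_Lp[OF r A disj r0 n0 n1] v h dist L
      by (intro exI[of _ m] exI[of _ "ae_class M r"]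
          exI[of _ "\<lambda>i x. ae_class M (\<lambda>\<omega>. indicator (A i) \<omega> *\<^sub>R (norm (v i) *\<^sub>R x))"] exI[of _ w])
        (simp add: w_def ndist_Lp)
  qed
qed

end

text \<open>On a null space any two functions agree almost everywhere. Used contrapositively, this
  turns nontriviality of the scalar space into positivity of the measure.\<close>

lemma Lp_trivial:
  assumes "space M \<in> null_sets M"
  shows "ncarrier (Lp M p T) \<subseteq> {nzero (Lp M p T)}"
proof
  fix F assume "F \<in> ncarrier (Lp M p T)"
  then obtain f where f: "Bochner_measurable M f" "F = ae_class M f"
    unfolding Lp_def nspace.select_convs Lp_functions_def ae_class_def by (auto elim!: quotientE)
  have "AE x in M. f x = 0"
    using AE_not_in[OF assms] AE_space by eventually_elim simp
  then have "ae_class M f = ae_class M (\<lambda>_. 0)"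
    by (rule ae_class_eqI[OF f(1) Bochner_measurable_const])
  with f(2) show "F \<in> {nzero (Lp M p T)}"
    by (simp add: Lp_def)
qed

theorem corollary4p2:
  fixes M :: "'w measure" and p :: ennreal
  assumes nontrivial: "\<exists>x::'a::banach. x \<noteq> 0"
    and finite: "finite_measure M"
    and p: "1 \<le> p"
    and Lp_nontrivial: "ncarrier (Lp M p TYPE(real)) \<noteq> {nzero (Lp M p TYPE(real))}"
  shows "(DD2P (space_of TYPE('a)) \<longrightarrow> DD2P (Lp M p TYPE('a))) \<and>
         (DLD2P (space_of TYPE('a)) \<longrightarrow> DLD2P (Lp M p TYPE('a))) \<and>
         (convex_DLD2P (space_of TYPE('a)) \<longrightarrow> convex_DLD2P (Lp M p TYPE('a)))"
proof -
  interpret Lp_exponent M p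
    using finite p by (simp add: Lp_exponent_def Lp_exponent_axioms_def)
  \<comment> \<open>\<open>Lp_trivial\<close> gives only an inclusion; membership of zero makes it
    the equality that the hypothesis excludes.\<close>
  have "nzero (Lp M p TYPE(real)) \<in> ncarrier (Lp M p TYPE(real))"
    using Lp_carrier_ae_class[OF simple_function_Lp_functions[OF simple_function_const]]
    by (simp add: Lp_def)
  with Lp_nontrivial have "space M \<notin> null_sets M"
    using Lp_trivial[of M p "TYPE(real)"] by blast
  then interpret directional_nspace "Lp M p TYPE('a)" "TYPE('a)"
    using nontrivial by (rule directional_nspace_Lp)
  show ?thesis
    using DD2P_transfer DLD2P_transfer convex_DLD2P_transfer by blast
qed

end
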